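(* Let $\phi \in H^{\infty}(\mathbb{D})$, let $T_{\phi}: H^2(\mathbb{D})\to H^2(\mathbb{D})$, $T_\phi g=\phi g$, be the associated multiplication operator, and let $f\in H^2(\mathbb{D})$. If the system $\{T_{\phi}^n f\}_{n=0}^{\infty}=\{\phi^n f\}_{n=0}^\infty$ is a frame for $H^2(\mathbb{D})$, then $\phi$ is an inner function.
   Context: $\mathbb{D}=\{z\in\mathbb{C}:|z|<1\}$ is the open unit disk and $\mathbb{T}=\{z\in\mathbb{C}:|z|=1\}$ the unit circle. $H^\infty(\mathbb{D})$ is the Banach space of bounded holomorphic functions on $\mathbb{D}$ with norm $\|\phi\|_\infty=\sup_{z\in\mathbb{D}}|\phi(z)|$. $H^2(\mathbb{D})$ is the Hardy space of holomorphic functions $f(z)=\sum_{n\ge 0}a_nz^n$ on $\mathbb{D}$ with $\|f\|_2^2=\sum_{n\ge0}|a_n|^2<\infty$; it is a Hilbert space with inner product $\langle f,g\rangle=\int_0^{2\pi} f(e^{i\theta})\overline{g(e^{i\theta})}\,\frac{d\theta}{2\pi}$, computed from radial boundary values. A function $\phi\in H^\infty(\mathbb{D})$ is inner if its radial boundary values satisfy $|\phi(e^{i\theta})|=1$ a.e. on $\mathbb{T}$. The sequence $\{\phi^n f\}_{n=0}^\infty\subset H^2(\mathbb{D})$ is a frame for $H^2(\mathbb{D})$ if there exist constants $A,B>0$ such that $A\|g\|_2^2\le\sum_{n=0}^\infty|\langle g,\phi^n f\rangle|^2\le B\|g\|_2^2$ for all $g\in H^2(\mathbb{D})$. *)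

theory Defs
  imports "HOL-Complex_Analysis.Complex_Analysis"
begin

text \<open>
  Functions on the open unit disk \<open>ball 0 1\<close> are represented by total functions on the complex
  plane; every notion below depends only on their values on \<open>ball 0 1\<close>.
\<close>

definition Hinf :: "(complex \<Rightarrow> complex) set" where
  "Hinf = {\<phi>. \<phi> holomorphic_on ball 0 1 \<and> bounded (\<phi> ` ball 0 1)}"

definition taylor_coeff :: "(complex \<Rightarrow> complex) \<Rightarrow> nat \<Rightarrow> complex" where
  "taylor_coeff f n = (deriv ^^ n) f 0 / fact n"

definition H2 :: "(complex \<Rightarrow> complex) set" where
  "H2 = {f. f holomorphic_on ball 0 1 \<and> summable (\<lambda>n. (cmod (taylor_coeff f n))\<^sup>2)}"

definition H2_norm :: "(complex \<Rightarrow> complex) \<Rightarrow> real" where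
  "H2_norm f = sqrt (\<Sum>n. (cmod (taylor_coeff f n))\<^sup>2)"

text \<open>
  The radial boundary value of \<open>f\<close> at \<open>exp (\<i> \<theta>)\<close>. It is an unspecified value if the radial limit
  does not exist, which for functions in \<open>H2\<close> happens only for \<open>\<theta>\<close> in a null set.
\<close>

definition radial_value :: "(complex \<Rightarrow> complex) \<Rightarrow> real \<Rightarrow> complex" where
  "radial_value f \<theta> = Lim (at_left (1::real)) (\<lambda>r. f (of_real r * cis \<theta>))"

definition H2_inner :: "(complex \<Rightarrow> complex) \<Rightarrow> (complex \<Rightarrow> complex) \<Rightarrow> complex" where
  "H2_inner f g =
     (LINT \<theta>|lebesgue_on {0..2*pi}. radial_value f \<theta> * cnj (radial_value g \<theta>)) / (2 * pi)"

text \<open>The existence of the radial limits almost everywhere is made explicit.\<close>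

definition inner_function :: "(complex \<Rightarrow> complex) \<Rightarrow> bool" where
  "inner_function \<phi> \<longleftrightarrow> \<phi> \<in> Hinf \<and>
     (AE \<theta> in lebesgue_on {0..2*pi}.
        ((\<lambda>r. \<phi> (of_real r * cis \<theta>)) \<longlongrightarrow> radial_value \<phi> \<theta>) (at_left (1::real)) \<and>
        cmod (radial_value \<phi> \<theta>) = 1)"

definition mult_op :: "(complex \<Rightarrow> complex) \<Rightarrow> (complex \<Rightarrow> complex) \<Rightarrow> complex \<Rightarrow> complex" where
  "mult_op \<phi> g = (\<lambda>z. \<phi> z * g z)"

text \<open>
  Summability is required explicitly because \<open>suminf\<close> of a divergent real series is a junk value;
  with sums in \<open>[0, \<infinity>]\<close> it is part of the upper bound.
\<close>

definition H2_frame :: "(nat \<Rightarrow> complex \<Rightarrow> complex) \<Rightarrow> bool" where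
  "H2_frame e \<longleftrightarrow> range e \<subseteq> H2 \<and>
     (\<exists>A>0. \<exists>B>0. \<forall>g\<in>H2.
        summable (\<lambda>n. (cmod (H2_inner g (e n)))\<^sup>2) \<and>
        A * (H2_norm g)\<^sup>2 \<le> (\<Sum>n. (cmod (H2_inner g (e n)))\<^sup>2) \<and>
        (\<Sum>n. (cmod (H2_inner g (e n)))\<^sup>2) \<le> B * (H2_norm g)\<^sup>2)"

end

theory Submission
  imports Defs
begin

text \<open>
  Test the frame inequality on the Szego kernels \<open>k\<^sub>w z = 1 / (1 - cnj w * z)\<close>. They reproduce
  point values, so the inner product of \<open>k\<^sub>w\<close> with \<open>\<phi>\<^sup>n f\<close> is the conjugate of \<open>\<phi> w ^ n * f w\<close>,
  and \<open>k\<^sub>w\<close> has squared norm \<open>1 / (1 - \<bar>w\<bar>\<^sup>2)\<close>. Summing a geometric series, the lower frame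
  bound \<open>A\<close> says that \<open>\<bar>\<phi> w\<bar> < 1\<close> and \<open>A (1 - \<bar>\<phi> w\<bar>\<^sup>2) \<le> (1 - \<bar>w\<bar>\<^sup>2) \<bar>f w\<bar>\<^sup>2\<close>
  (\<open>frame_lower_bound_on_kernels\<close>). At almost every boundary point \<open>f\<close> has a finite radial
  limit, so the right-hand side tends to \<open>0\<close> along the radius and \<open>\<bar>\<phi>\<bar>\<close> tends to \<open>1\<close>.

  The inner product is an integral of radial boundary values, so this argument rests on two
  classical facts about \<open>H2\<close>: radial limits exist almost everywhere (\<open>H2_radial_limits\<close>), and
  the Szego kernel reproduces point values through boundary integrals (\<open>H2_inner_szego_kernel\<close>).

  For the first, write \<open>F\<close> as its dilate \<open>F (\<rho> z)\<close>, continuous up to the circle, plus a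
  difference whose \<open>H2\<close> norm tends to \<open>0\<close> as \<open>\<rho>\<close> tends to \<open>1\<close>. It suffices that the radial
  maximal function of the difference is small off a set of small measure
  (\<open>measure_radial_exceedance\<close>). This weak-type bound comes from Poisson's formula, whose kernel
  is even and decreasing: a Poisson integral is at most the supremum of the averages over
  centred intervals (\<open>norm_le_of_circle_averages_le\<close>), and these are controlled by Vitali's
  covering lemma (\<open>centred_maximal_covering\<close>). The bound involves the integral of the modulus;
  since the square of a holomorphic function is holomorphic, it applies to the square of the
  difference and thus yields a bound by the \<open>H2\<close> norm.

  For the second, Parseval's identity gives the reproducing formula for the dilates, and Fatou's
  lemma shows that the dilates converge to the boundary values in the mean.
\<close>

section \<open>Absolutely convergent Fourier series\<close>

definition circle_series :: "(nat \<Rightarrow> complex) \<Rightarrow> real \<Rightarrow> complex" where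
  "circle_series a t = (\<Sum>n. a n * cis t ^ n)"

lemma uniform_limit_circle_series:
  assumes "summable (\<lambda>n. norm (a n))"
  shows "uniform_limit X (\<lambda>N t. \<Sum>n<N. a n * cis t ^ n) (circle_series a) sequentially"
proof -
  have "uniform_limit X (\<lambda>N t. \<Sum>n<N. a n * cis t ^ n) (\<lambda>t. \<Sum>n. a n * cis t ^ n) sequentially"
    by (rule Weierstrass_m_test[OF _ assms]) (simp add: norm_mult norm_power)
  then show ?thesis by (simp add: circle_series_def[abs_def])
qed

lemma continuous_on_circle_series:
  assumes "summable (\<lambda>n. norm (a n))"
  shows "continuous_on X (circle_series a)"
  by (rule uniform_limit_theorem[OF _ uniform_limit_circle_series[OF assms]])
     (auto intro!: always_eventually continuous_intros)

text \<open>
  Absolute summability makes the series converge uniformly on the circle, so it can be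
  integrated term by term against a continuous function.
\<close>
lemma integral_times_cnj_circle_series:
  assumes b: "summable (\<lambda>n. norm (b n))" and G: "continuous_on {0..2*pi} G"
  shows "(\<lambda>n. cnj (b n) * integral {0..2*pi} (\<lambda>t. G t * cnj (cis t ^ n)))
           sums integral {0..2*pi} (\<lambda>t. G t * cnj (circle_series b t))"
proof -
  have "compact (G ` {0..2*pi})" using G by (intro compact_continuous_image) auto
  then obtain C where C: "\<And>t. t \<in> {0..2*pi} \<Longrightarrow> norm (G t) \<le> C"
    by (meson bounded_iff compact_imp_bounded imageI)
  have u1: "uniform_limit {0..2*pi} (\<lambda>N t. \<Sum>n<N. G t * cnj (b n * cis t ^ n))
       (\<lambda>t. \<Sum>n. G t * cnj (b n * cis t ^ n)) sequentially"
  proof (rule Weierstrass_m_test)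
    show "summable (\<lambda>n. C * norm (b n))" using b by (rule summable_mult)
    show "norm (G t * cnj (b n * cis t ^ n)) \<le> C * norm (b n)" if "t \<in> {0..2*pi}" for n t
      using C[OF that] by (auto simp: norm_mult norm_power intro!: mult_right_mono)
  qed
  have eq: "(\<Sum>n. G t * cnj (b n * cis t ^ n)) = G t * cnj (circle_series b t)" for t
  proof -
    have "summable (\<lambda>n. b n * cis t ^ n)"
      by (rule summable_norm_cancel) (use b in \<open>simp add: norm_mult norm_power\<close>)
    then have "(\<lambda>n. b n * cis t ^ n) sums circle_series b t"
      by (simp add: circle_series_def summable_sums)
    then have "(\<lambda>n. G t * cnj (b n * cis t ^ n)) sums (G t * cnj (circle_series b t))"
      by (intro sums_mult) (simp only: sums_cnj)
    then show ?thesis by (simp add: sums_iff)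
  qed
  have u: "uniform_limit {0..2*pi} (\<lambda>N t. \<Sum>n<N. G t * cnj (b n * cis t ^ n))
       (\<lambda>t. G t * cnj (circle_series b t)) sequentially"
    using u1 unfolding eq .
  obtain I J where I: "\<And>N. ((\<lambda>t. \<Sum>n<N. G t * cnj (b n * cis t ^ n)) has_integral I N) {0..2*pi}"
     and J: "((\<lambda>t. G t * cnj (circle_series b t)) has_integral J) {0..2*pi}" and lim: "I \<longlonglongrightarrow> J"
    by (rule uniform_limit_integral[OF u]) (auto intro!: continuous_intros G)
  have i: "(\<lambda>t. G t * cnj (cis t ^ n)) integrable_on {0..2*pi}" for n
    by (intro integrable_continuous_interval continuous_intros G)
  have "I N = (\<Sum>n<N. cnj (b n) * integral {0..2*pi} (\<lambda>t. G t * cnj (cis t ^ n)))" for N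
  proof -
    have "((\<lambda>t. \<Sum>n<N. cnj (b n) * (G t * cnj (cis t ^ n))) has_integral
           (\<Sum>n<N. cnj (b n) * integral {0..2*pi} (\<lambda>t. G t * cnj (cis t ^ n)))) {0..2*pi}"
      by (intro has_integral_sum has_integral_mult_right integrable_integral i) auto
    with I[of N] show ?thesis by (simp add: mult_ac has_integral_unique)
  qed
  then have "I = (\<lambda>N. \<Sum>n<N. cnj (b n) * integral {0..2*pi} (\<lambda>t. G t * cnj (cis t ^ n)))" by blast
  with lim show ?thesis unfolding sums_def integral_unique[OF J] by (simp only:)
qed

lemma integral_cis_power_orthogonal:
  "integral {0..2*pi} (\<lambda>t. cis t ^ m * cnj (cis t ^ n)) = (if m = n then 2 * pi else 0)"
proof -
  define k :: real where "k = real m - real n"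
  have e: "cis t ^ m * cnj (cis t ^ n) = cis (k * t)" for t
    by (simp add: k_def Complex.DeMoivre cis_cnj cis_mult algebra_simps)
  show ?thesis
  proof (cases "m = n")
    case True
    then show ?thesis unfolding e by (simp add: k_def scaleR_conv_of_real)
  next
    case False
    then have k: "k \<noteq> 0" by (simp add: k_def)
    have d: "((\<lambda>t. cis (k * t) / (\<i> * k)) has_vector_derivative cis (k *
      t)) (at t within {0..2*pi})" for t
    proof -
      have "((\<lambda>t. cis (k * t)) has_derivative (\<lambda>x. (k * x) *\<^sub>R (\<i> * cis (k *
        t)))) (at t within {0..2*pi})"
        by (auto intro!: derivative_eq_intros)
      then have "((\<lambda>t. cis (k * t)) has_vector_derivative (k *\<^sub>R (\<i> * cis (k *
        t)))) (at t within {0..2*pi})"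
        by (simp add: has_vector_derivative_def mult_ac)
      from has_vector_derivative_divide[OF this, of "\<i> * k"] k show ?thesis
        by (simp add: scaleR_conv_of_real)
    qed
    have "((\<lambda>t. cis (k * t)) has_integral (cis (k * (2*pi)) / (\<i> * k) - cis (k * 0) / (\<i> *
      k))) {0..2*pi}"
      by (rule fundamental_theorem_of_calculus) (use d in auto)
    moreover have "cis (k * (2*pi)) = 1"
    proof -
      have "k * (2*pi) = 2 * pi * of_int (int m - int n)" by (simp add: k_def)
      then show ?thesis by (metis cis_multiple_2pi Ints_of_int)
    qed
    ultimately show ?thesis unfolding e using False by (simp add: integral_unique)
  qed
qed

text \<open>
  Termwise integration against \<open>cis t ^ m\<close> identifies the Fourier coefficients of \<open>circle_series
  a\<close>; termwise integration of \<open>circle_series b\<close> against \<open>circle_series a\<close> then produces exactly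
  these coefficients.
\<close>
lemma parseval_circle_series:
  assumes a: "summable (\<lambda>n. norm (a n))" and b: "summable (\<lambda>n. norm (b n))"
  shows "(\<lambda>n. a n * cnj (b n)) sums
          (integral {0..2*pi} (\<lambda>t. circle_series a t * cnj (circle_series b t)) / (2 * pi))"
proof -
  have m: "integral {0..2*pi} (\<lambda>t. circle_series a t * cnj (cis t ^ m)) = 2 * pi * a m" for m
  proof -
    have "(\<lambda>n. cnj (a n) * (if m = n then 2 * pi else 0)) sums
       integral {0..2*pi} (\<lambda>t. cis t ^ m * cnj (circle_series a t))"
      using integral_times_cnj_circle_series[OF a, of "\<lambda>t. cis t ^ m"]
      unfolding integral_cis_power_orthogonal by (simp add: continuous_intros)
    moreover have "(\<lambda>n. cnj (a n) * (if m = n then 2 * pi else 0)) = (\<lambda>n.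
      if n = m then cnj (a m) * (2*pi) else 0)" by auto
    ultimately have "integral {0..2*pi} (\<lambda>t. cis t ^ m * cnj (circle_series a t)) =
      cnj (a m) * (2*pi)"
      using sums_single[of m "\<lambda>n. cnj (a m) * (2*pi)"] by (simp add: sums_unique2)
    then have "cnj (integral {0..2*pi} (\<lambda>t. cis t ^ m * cnj (circle_series a t))) = a m * (2*pi)"
      by simp
    then show ?thesis by (simp add: integral_cnj mult_ac)
  qed
  have "(\<lambda>n. cnj (b n) * (2 * pi * a n)) sums integral {0..2*pi} (\<lambda>t. circle_series a t *
    cnj (circle_series b t))"
    using integral_times_cnj_circle_series[OF b continuous_on_circle_series[OF a]] by (simp only: m)
  from sums_divide[OF this, of "2 * pi"] show ?thesis by (simp add: mult_ac)
qed

section \<open>Taylor coefficients\<close>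

lemma taylor_sums:
  assumes "h holomorphic_on ball 0 \<rho>" "norm z < \<rho>"
  shows "(\<lambda>n. taylor_coeff h n * z ^ n) sums h z"
  using holomorphic_power_series[OF assms(1), of z] assms(2) by (simp add: taylor_coeff_def)

lemma summable_norm_taylor:
  assumes h: "h holomorphic_on ball 0 \<rho>" and r: "0 \<le> r" "r < \<rho>"
  shows "summable (\<lambda>n. norm (taylor_coeff h n) * r ^ n)"
proof -
  have "summable (\<lambda>n. taylor_coeff h n * of_real ((r + \<rho>)/2) ^ n)"
    using taylor_sums[OF h, of "of_real ((r + \<rho>)/2)"] r
    unfolding norm_of_real by (auto simp: sums_iff simp del: of_real_add of_real_divide)
  moreover have "norm (complex_of_real r) < norm (complex_of_real ((r + \<rho>)/2))"
    using r unfolding norm_of_real by auto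
  ultimately have "summable (\<lambda>n. norm (taylor_coeff h n * of_real r ^ n))" by (rule powser_insidea)
  then show ?thesis using r by (simp add: norm_mult norm_power)
qed

lemma taylor_coeff_unique:
  assumes "0 < \<rho>" "\<And>z. norm z < \<rho> \<Longrightarrow> (\<lambda>n. a n * z ^ n) sums h z"
  shows "taylor_coeff h n = a n"
proof -
  have "h has_fps_expansion Abs_fps a"
  proof (rule has_fps_expansionI)
    have "\<forall>\<^sub>F u in nhds (0::complex). u \<in> ball 0 \<rho>"
      using assms(1) by (intro eventually_nhds_in_open) auto
    then show "\<forall>\<^sub>F u in nhds 0. (\<lambda>n. fps_nth (Abs_fps a) n * u ^ n) sums h u"
      by eventually_elim (use assms(2) in auto)
  qed
  from fps_nth_fps_expansion[OF this, of n] show ?thesis by (simp add: taylor_coeff_def)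
qed

lemma circle_series_taylor:
  assumes "h holomorphic_on ball 0 \<rho>" "1 < \<rho>"
  shows "circle_series (taylor_coeff h) t = h (cis t)"
  using taylor_sums[OF assms(1), of "cis t"] assms(2) by (simp add: circle_series_def sums_iff)

lemma circle_series_geometric:
  assumes "norm w < 1"
  shows "circle_series (\<lambda>n. w ^ n) t = 1 / (1 - w * cis t)"
  using geometric_sums[of "w * cis t"] assms
  by (simp add: circle_series_def sums_iff norm_mult power_mult_distrib)

section \<open>The Poisson integral\<close>

definition poisson_kernel :: "real \<Rightarrow> real \<Rightarrow> real" where
  "poisson_kernel r t = (1 - r\<^sup>2) / (1 - 2 * r * cos t + r\<^sup>2)"

lemma poisson_denominator_pos:
  fixes r t :: real
  assumes "0 \<le> r" "r < 1"
  shows "0 < 1 - 2 * r * cos t + r\<^sup>2"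
proof -
  have "r * cos t \<le> r * 1" using assms cos_le_one[of t] by (intro mult_left_mono)
  moreover have "0 < (1 - r)\<^sup>2" using assms by simp
  moreover have "(1 - r)\<^sup>2 = 1 - 2 * r + r\<^sup>2" by (simp add: power2_eq_square algebra_simps)
  ultimately show ?thesis by linarith
qed

lemma continuous_on_poisson_kernel:
  assumes "0 \<le> r" "r < 1"
  shows "continuous_on S (poisson_kernel r)"
  unfolding poisson_kernel_def[abs_def] using poisson_denominator_pos[OF assms]
  by (intro continuous_intros) (metis less_irrefl)

lemma poisson_kernel_pos: "0 \<le> r \<Longrightarrow> r < 1 \<Longrightarrow> 0 < poisson_kernel r t"
  unfolding poisson_kernel_def using poisson_denominator_pos[of r t]
  by (simp add: abs_square_less_1)

text \<open>
  Parseval's identity for \<open>g z = h z (1 - r\<^sup>2) / (1 - r z)\<close> and the geometric series with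
  coefficients \<open>r ^ n\<close>. The latter reproduces the value of \<open>g\<close> at \<open>r\<close>, which is \<open>h r\<close>, while the
  product of the two denominators on the circle is that of the Poisson kernel.
\<close>
lemma poisson_formula_circle:
  assumes h: "h holomorphic_on ball 0 \<rho>" "1 < \<rho>" and r: "0 \<le> r" "r < 1"
  shows "h (of_real r) = integral {0..2*pi} (\<lambda>t. of_real (poisson_kernel r t) * h (cis t)) / (2 *
    pi)"
proof -
  \<comment> \<open>A radius beyond \<open>1\<close> that stays below the pole of \<open>g\<close> at \<open>1 / r\<close>.\<close>
  define \<rho>' where "\<rho>' = min \<rho> (2 / (1 + r))"
  define g where "g z = h z * (1 - (of_real r)\<^sup>2) / (1 - of_real r * z)" for z :: complex
  have \<rho>': "1 < \<rho>'" "r * \<rho>' < 1"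
  proof -
    show "1 < \<rho>'" using assms by (simp add: \<rho>'_def field_simps)
    have "r * \<rho>' \<le> r * (2 / (1 + r))" using r by (intro mult_left_mono) (auto simp: \<rho>'_def)
    also have "\<dots> < 1" using r by (simp add: field_simps)
    finally show "r * \<rho>' < 1" .
  qed
  have nz: "1 - of_real r * z \<noteq> 0" if "norm z < \<rho>'" for z :: complex
  proof
    assume "1 - of_real r * z = 0"
    then have "norm (of_real r * z) = 1" by simp
    moreover have "norm (of_real r * z) \<le> r * \<rho>'"
      using r that by (auto simp: norm_mult intro!: mult_left_mono)
    ultimately show False using \<rho>'(2) by simp
  qed
  have g: "g holomorphic_on ball 0 \<rho>'"
    unfolding g_def[abs_def] using nz
    by (intro holomorphic_intros holomorphic_on_subset[OF h(1)]) (auto simp: \<rho>'_def)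
  have sa: "summable (\<lambda>n. norm (taylor_coeff g n))"
    using summable_norm_taylor[OF g, of 1] \<rho>'(1) by simp
  have sb: "summable (\<lambda>n. norm (complex_of_real r ^ n))"
    using r by (simp add: norm_power summable_geometric)
  have "(\<lambda>n. taylor_coeff g n * of_real r ^ n) sums
     (integral {0..2*pi} (\<lambda>t. circle_series (taylor_coeff g) t *
       cnj (circle_series (\<lambda>n. of_real r ^ n) t)) / (2 * pi))"
    using parseval_circle_series[OF sa sb] by simp
  moreover have "(\<lambda>n. taylor_coeff g n * of_real r ^ n) sums g (of_real r)"
    by (rule taylor_sums[OF g]) (use r \<rho>' in auto)
  ultimately have *: "g (of_real r) = integral {0..2*pi} (\<lambda>t. circle_series (taylor_coeff g) t *
       cnj (circle_series (\<lambda>n. of_real r ^ n) t)) / (2 * pi)"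
    by (rule sums_unique2[symmetric])
  have **: "circle_series (taylor_coeff g) t * cnj (circle_series (\<lambda>n. of_real r ^ n) t) =
      of_real (poisson_kernel r t) * h (cis t)" for t
  proof -
    have "(1 - of_real r * cis t) * cnj (1 - of_real r * cis t) = of_real (1 - 2 * r * cos t + r\<^sup>2)"
    proof -
      have "(1 - r * cos t)\<^sup>2 + (r * sin t)\<^sup>2 = 1 - 2 * r * cos t + r\<^sup>2 * ((sin t)\<^sup>2 + (cos t)\<^sup>2)"
        unfolding power2_eq_square by algebra
      then show ?thesis by (simp add: complex_mult_cnj complex_eq_iff del: complex_cnj_diff)
    qed
    then show ?thesis using circle_series_taylor[OF g \<rho>'(1)] circle_series_geometric[of "of_real r"
      t] r
      by (simp add: g_def poisson_kernel_def)
  qed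
  have "1 - (complex_of_real r)\<^sup>2 \<noteq> 0"
  proof -
    have "r\<^sup>2 < 1" using r by (simp add: abs_square_less_1)
    then have "complex_of_real (1 - r\<^sup>2) \<noteq> 0" unfolding of_real_eq_0_iff by simp
    then show ?thesis by simp
  qed
  then have "g (of_real r) = h (of_real r)" by (simp add: g_def power2_eq_square)
  with * show ?thesis unfolding ** by simp
qed

lemma integral_fold_circle:
  fixes q :: "real \<Rightarrow> complex"
  assumes "continuous_on {0..2*pi} q"
  shows "integral {0..2*pi} q = integral {0..pi} (\<lambda>t. q t + q (2*pi - t))"
proof -
  have c1: "continuous_on {0..pi} q" and c2: "continuous_on {pi..2*pi} q"
    by (auto intro: continuous_on_subset[OF assms])
  have c3: "continuous_on {0..pi} (\<lambda>t. q (2*pi - t))"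
    by (rule continuous_on_compose2[OF c2]) (auto intro!: continuous_intros)
  have "integral {0..2*pi} q = integral {0..pi} q + integral {pi..2*pi} q"
    by (rule Henstock_Kurzweil_Integration.integral_combine[symmetric])
       (auto intro!: integrable_continuous_interval assms)
  also have "integral {pi..2*pi} q = integral {-(2*pi)..-pi} (\<lambda>t. q (-t))"
    by simp
  also have "\<dots> = integral {0..pi} (\<lambda>t. q (-(t - 2 * pi)))"
    using integral_shift_real_ivl[of "-(2*pi)" "-(2*pi)" "-pi" "\<lambda>t. q (-t)"] by simp
  also have "integral {0..pi} q + \<dots> = integral {0..pi} (\<lambda>t. q t + q (2*pi - t))"
    using integral_add[of q "{0..pi}" "\<lambda>t. q (2*pi - t)"] c1 c3
    by (simp add: integrable_continuous_interval)
  finally show ?thesis .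
qed

lemma poisson_formula:
  assumes h: "h holomorphic_on ball 0 \<rho>" "1 < \<rho>" and r: "0 \<le> r" "r < 1"
  shows "h (of_real r * cis \<theta>) = integral {0..pi} (\<lambda>t. of_real (poisson_kernel r t) *
           (h (cis (\<theta> + t)) + h (cis (\<theta> - t)))) / (2 * pi)"
proof -
  define g where "g z = h (z * cis \<theta>)" for z
  have g: "g holomorphic_on ball 0 \<rho>"
    unfolding g_def[abs_def]
    by (rule holomorphic_on_compose_gen[OF _ h(1), unfolded o_def])
       (auto intro!: holomorphic_intros simp: norm_mult)
  have "continuous_on {0..2*pi} (\<lambda>t. g (cis t))"
    by (rule continuous_on_compose2[OF holomorphic_on_imp_continuous_on[OF g]])
       (use h in \<open>auto intro!: continuous_intros\<close>)
  then have c: "continuous_on {0..2*pi} (\<lambda>t. of_real (poisson_kernel r t) * g (cis t))"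
    by (intro continuous_intros continuous_on_poisson_kernel r)
  have e: "of_real (poisson_kernel r t) * g (cis t) +
    of_real (poisson_kernel r (2*pi - t)) * g (cis (2*pi - t)) =
       of_real (poisson_kernel r t) * (h (cis (\<theta> + t)) + h (cis (\<theta> - t)))" for t
  proof -
    have "cis (2*pi - t) * cis \<theta> = cis (\<theta> - t)"
      by (simp add: cis_mult complex_eq_iff cos_diff sin_diff cos_add sin_add)
    moreover have "cis t * cis \<theta> = cis (\<theta> + t)" by (simp add: cis_mult add.commute)
    moreover have "poisson_kernel r (2*pi - t) = poisson_kernel r t"
      by (simp add: poisson_kernel_def cos_diff)
    ultimately show ?thesis by (simp add: g_def distrib_left)
  qed
  have "g (of_real r) = integral {0..2*pi} (\<lambda>t. of_real (poisson_kernel r t) * g (cis t)) / (2 *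
    pi)"
    by (rule poisson_formula_circle[OF g h(2) r])
  then show ?thesis unfolding integral_fold_circle[OF c] e by (simp add: g_def)
qed

lemma integral_poisson_kernel:
  assumes "0 \<le> r" "r < 1"
  shows "integral {0..pi} (poisson_kernel r) = pi"
proof -
  have c: "poisson_kernel r integrable_on {0..pi}"
    by (intro integrable_continuous_interval continuous_on_poisson_kernel assms)
  have "1 = integral {0..pi} (\<lambda>t. complex_of_real (poisson_kernel r t) * 2) / (2 * pi)"
    using poisson_formula[of "\<lambda>_. 1" 2 r 0] assms by simp
  also have "\<dots> = integral {0..pi} (\<lambda>t. complex_of_real (poisson_kernel r t)) / pi"
    by simp
  also have "integral {0..pi} (\<lambda>t. complex_of_real (poisson_kernel r t)) =
    of_real (integral {0..pi} (poisson_kernel r))"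
    using integral_linear[OF c bounded_linear_of_real] by (simp add: o_def)
  finally have "complex_of_real (integral {0..pi} (poisson_kernel r) / pi) = 1" by simp
  then show ?thesis unfolding of_real_eq_1_iff by simp
qed

text \<open>
  Let \<open>H t\<close> be the integral of \<open>v - \<mu>\<close> over \<open>[0, t]\<close>, so \<open>H \<le> 0\<close>. The derivative of \<open>H K\<close> is \<open>(v
  - \<mu>) K + H K'\<close>, and its last summand is nonnegative since \<open>K\<close> decreases. Hence \<open>(v - \<mu>) K\<close> has
  integral at most \<open>H b * K b \<le> 0\<close>. With the Poisson kernel for \<open>K\<close> this bounds Poisson
  integrals by averages over centred intervals, with no loss in the constant.
\<close>
lemma integral_decreasing_kernel_le:
  fixes v K K' :: "real \<Rightarrow> real"
  assumes b: "0 \<le> b" and v: "continuous_on {0..b} v"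
    and K: "\<And>t. t \<in> {0..b} \<Longrightarrow> (K has_real_derivative K' t) (at t within {0..b})"
    and K': "\<And>t. t \<in> {0..b} \<Longrightarrow> K' t \<le> 0" and Kb: "0 \<le> K b"
    and avg: "\<And>t. t \<in> {0..b} \<Longrightarrow> integral {0..t} v \<le> \<mu> * t"
  shows "integral {0..b} (\<lambda>t. K t * v t) \<le> \<mu> * integral {0..b} K"
proof -
  define H where "H t = integral {0..t} v - \<mu> * t" for t
  have dH: "(H has_real_derivative (v t - \<mu>)) (at t within {0..b})" if "t \<in> {0..b}" for t
  proof -
    have "((\<lambda>u. integral {0..u} v) has_real_derivative v t) (at t within {0..b})"
      using integral_has_vector_derivative[OF v that]
      by (simp add: has_real_derivative_iff_has_vector_derivative)
    then show ?thesis unfolding H_def[abs_def] by (auto intro!: derivative_eq_intros)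
  qed
  have contK: "continuous_on {0..b} K"
    using K by (meson DERIV_continuous continuous_on_eq_continuous_within)
  have ftc: "((\<lambda>t. H t * K' t + (v t - \<mu>) * K t) has_integral (H b * K b - H 0 * K 0)) {0..b}"
    by (rule fundamental_theorem_of_calculus[OF b])
       (use DERIV_mult[OF dH K] in \<open>simp add:
         has_real_derivative_iff_has_vector_derivative[symmetric] mult_ac add_ac\<close>)
  have i: "(\<lambda>t. (v t - \<mu>) * K t) integrable_on {0..b}"
    by (intro integrable_continuous_interval continuous_intros v contK)
  have "integral {0..b} (\<lambda>t. (v t - \<mu>) * K t) \<le> H b * K b - H 0 * K 0"
    by (rule has_integral_le[OF integrable_integral[OF i] ftc])
       (use avg K' in \<open>auto simp: H_def mult_nonpos_nonpos\<close>)
  also have "\<dots> \<le> 0"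
    using avg[of b] b Kb by (simp add: H_def mult_nonpos_nonneg)
  also have "integral {0..b} (\<lambda>t. (v t - \<mu>) * K t) =
    integral {0..b} (\<lambda>t. K t * v t) - \<mu> * integral {0..b} K"
  proof -
    have "integral {0..b} (\<lambda>t. K t * v t - \<mu> * K t) =
      integral {0..b} (\<lambda>t. K t * v t) - integral {0..b} (\<lambda>t. \<mu> * K t)"
      by (intro Henstock_Kurzweil_Integration.integral_diff integrable_continuous_interval
      continuous_intros v contK)
    then show ?thesis by (simp add: algebra_simps)
  qed
  finally show ?thesis by simp
qed

text \<open>
  The Poisson kernel is even and decreasing on \<open>{0..pi}\<close>, with integral \<open>pi\<close> there.
\<close>
lemma norm_le_of_circle_averages_le:
  assumes h: "h holomorphic_on ball 0 \<rho>" "1 < \<rho>" and r: "0 \<le> r" "r < 1"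
    and avg: "\<And>t. t \<in> {0..pi} \<Longrightarrow>
       integral {0..t} (\<lambda>s. norm (h (cis (\<theta> + s))) + norm (h (cis (\<theta> - s)))) \<le> 2 * \<mu> * t"
  shows "norm (h (of_real r * cis \<theta>)) \<le> \<mu>"
proof -
  have hc: "continuous_on X (\<lambda>t. h (cis (f t)))" if "continuous_on X f" for X f
    by (rule continuous_on_compose2[OF holomorphic_on_imp_continuous_on[OF h(1)]])
       (use h that in \<open>auto intro!: continuous_intros\<close>)
  define v where "v s = norm (h (cis (\<theta> + s))) + norm (h (cis (\<theta> - s)))" for s
  have v: "continuous_on X v" for X unfolding v_def by (intro continuous_intros hc)
  define K' where "K' t = - ((1 - r\<^sup>2) * (2 * r * sin t)) / (1 - 2 * r * cos t + r\<^sup>2)\<^sup>2" for t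
  have "norm (integral {0..pi} (\<lambda>t. of_real (poisson_kernel r t) * (h (cis (\<theta> + t)) +
    h (cis (\<theta> - t)))))
     \<le> integral {0..pi} (\<lambda>t. poisson_kernel r t * v t)"
  proof (rule integral_norm_bound_integral)
    show "(\<lambda>t. complex_of_real (poisson_kernel r t) * (h (cis (\<theta> + t)) +
      h (cis (\<theta> - t)))) integrable_on {0..pi}"
      by (intro integrable_continuous_interval continuous_intros hc continuous_on_poisson_kernel r)
    show "(\<lambda>t. poisson_kernel r t * v t) integrable_on {0..pi}"
      by (intro integrable_continuous_interval continuous_intros v continuous_on_poisson_kernel r)
    show "norm (complex_of_real (poisson_kernel r t) * (h (cis (\<theta> + t)) + h (cis (\<theta> - t)))) \<le>
      poisson_kernel r t * v t" for t
      using poisson_kernel_pos[OF r, of t]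
      by (auto simp: norm_mult v_def intro!: mult_left_mono norm_triangle_ineq)
  qed
  also have "\<dots> \<le> (2 * \<mu>) * integral {0..pi} (poisson_kernel r)"
  proof (rule integral_decreasing_kernel_le[where K' = K'])
    fix t assume t: "t \<in> {0..pi}"
    show "(poisson_kernel r has_real_derivative K' t) (at t within {0..pi})"
      unfolding poisson_kernel_def[abs_def] K'_def using poisson_denominator_pos[OF r, of t]
      by (auto intro!: derivative_eq_intros simp: power2_eq_square)
    have "0 \<le> (1 - r\<^sup>2) * (2 * r * sin t)" using r t
      by (auto intro!: mult_nonneg_nonneg sin_ge_zero simp: abs_square_le_1)
    then show "K' t \<le> 0" by (simp add: K'_def divide_nonpos_nonneg)
    show "integral {0..t} v \<le> 2 * \<mu> * t" using avg[OF t] by (simp add: v_def[abs_def])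
  qed (use v poisson_kernel_pos[OF r, of pi] in auto)
  also have "\<dots> = 2 * pi * \<mu>" using integral_poisson_kernel[OF r] by simp
  finally show ?thesis unfolding poisson_formula[OF h r] by (simp add: norm_divide field_simps)
qed

section \<open>Maximal functions\<close>

text \<open>
  The weak-type bound for the Hardy--Littlewood maximal function. By Vitali's covering lemma
  some disjoint intervals among the given ones cover \<open>E\<close> after enlargement by the factor \<open>5\<close>,
  and the total length of disjoint intervals is controlled by the integral of \<open>u\<close>. The factor
  \<open>10\<close> occurs because the enlarged interval around \<open>\<theta>\<close> has length \<open>2 * 5 * t\<close>.
\<close>
lemma centred_maximal_covering:
  fixes u :: "real \<Rightarrow> real"
  assumes u: "continuous_on {a..b} u" "\<And>x. x \<in> {a..b} \<Longrightarrow> 0 \<le> u x" and \<mu>: "0 < \<mu>"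
    and E: "\<And>\<theta>. \<theta> \<in> E \<Longrightarrow> \<exists>t>0. {\<theta>-t..\<theta>+t} \<subseteq> {a..b} \<and> \<mu> * t < integral {\<theta>-t..\<theta>+t} u"
  obtains T where "E \<subseteq> T" "T \<in> lmeasurable" "measure lebesgue T \<le> 10 / \<mu> * integral {a..b} u"
proof -
  obtain r where r: "\<And>\<theta>. \<theta> \<in> E \<Longrightarrow> 0 < r \<theta>" "\<And>\<theta>. \<theta> \<in> E \<Longrightarrow> {\<theta> - r \<theta>..\<theta> + r \<theta>} \<subseteq> {a..b}"
      "\<And>\<theta>. \<theta> \<in> E \<Longrightarrow> \<mu> * r \<theta> < integral {\<theta> - r \<theta>..\<theta> + r \<theta>} u"
    using E by metis
  have "r \<theta> \<le> b - a" if "\<theta> \<in> E" for \<theta> using r(1,2)[OF that] by auto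
  moreover have "E \<subseteq> (\<Union>i\<in>E. cball i (r i))" using r(1) by force
  ultimately have "E \<subseteq> (\<Union>i\<in>E. cball i (r i))" "\<And>\<theta>. \<theta> \<in> E \<Longrightarrow> 0 < r \<theta> \<and> r \<theta> \<le> b - a"
    using r(1) by auto
  then obtain C where C: "countable C" "C \<subseteq> E"
      "pairwise (\<lambda>i j. disjnt (cball i (r i)) (cball j (r j))) C"
      "E \<subseteq> (\<Union>i\<in>C. cball i (5 * r i))"
    by (rule Vitali_covering_lemma_cballs[where S = E and K = E and a = "\<lambda>x. x" and r = r and B =
    "b - a"]) blast
  have cb: "cball x s = {x - s..x + s}" for x s :: real by (auto simp: cball_def dist_real_def)
  have ab: "u integrable_on {a..b}" by (intro integrable_continuous_interval u)
  have bound: "measure lebesgue (\<Union>i\<in>F. cball i (5 * r i)) \<le> 10 / \<mu> * integral {a..b} u"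
    if F: "F \<subseteq> C" "finite F" for F
  proof -
    have ui: "u integrable_on cball i (r i)" if "i \<in> F" for i
      unfolding cb using r(2) that F C(2)
      by (intro integrable_continuous_interval continuous_on_subset[OF u(1)]) auto
    have sum: "(u has_integral (\<Sum>i\<in>F. integral (cball i (r i)) u)) (\<Union>i\<in>F. cball i (r i))"
    proof (rule has_integral_UN)
      show "pairwise (\<lambda>i i'. negligible (cball i (r i) \<inter> cball i' (r i'))) F"
        using pairwise_subset[OF C(3) F(1)] by (auto simp: pairwise_def disjnt_def)
    qed (use F ui in auto)
    have "measure lebesgue (\<Union>i\<in>F. cball i (5 * r i)) \<le> (\<Sum>i\<in>F. measure lebesgue (cball i (5 * r i)))"
      by (rule measure_UNION_le) (use F in auto)
    also have "\<dots> \<le> (\<Sum>i\<in>F. 10 / \<mu> * integral (cball i (r i)) u)"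
    proof (rule sum_mono)
      fix i assume "i \<in> F"
      then have i: "i \<in> E" using F C by auto
      have "measure lebesgue (cball i (5 * r i)) = 10 * r i"
        using r(1)[OF i] by (simp add: cb)
      also have "\<dots> \<le> 10 / \<mu> * integral (cball i (r i)) u"
        using r(3)[OF i] \<mu> by (simp add: cb field_simps)
      finally show "measure lebesgue (cball i (5 * r i)) \<le> 10 / \<mu> * integral (cball i (r i)) u" .
    qed
    also have "\<dots> = 10 / \<mu> * integral (\<Union>i\<in>F. cball i (r i)) u"
      using integral_unique[OF sum] by (simp add: sum_distrib_left)
    also have "\<dots> \<le> 10 / \<mu> * integral {a..b} u"
    proof (intro mult_left_mono integral_subset_le)
      show "(\<Union>i\<in>F. cball i (r i)) \<subseteq> {a..b}" using r(2) F(1) C(2) by (force simp: cb)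
    qed (use sum ab u \<mu> in auto)
    finally show ?thesis .
  qed
  show thesis
  proof (rule that[OF C(4)])
    show "(\<Union>i\<in>C. cball i (5 * r i)) \<in> lmeasurable"
      by (rule fmeasurable_UN_bound[OF C(1) _ bound]) auto
    show "measure lebesgue (\<Union>i\<in>C. cball i (5 * r i)) \<le> 10 / \<mu> * integral {a..b} u"
      by (rule measure_UN_bound[OF C(1) _ bound]) auto
  qed
qed

lemma integral_symmetric_interval:
  fixes u :: "real \<Rightarrow> real"
  assumes u: "continuous_on UNIV u" and t: "0 \<le> t"
  shows "integral {0..t} (\<lambda>s. u (\<theta> + s) + u (\<theta> - s)) = integral {\<theta>-t..\<theta>+t} u"
proof -
  have c: "continuous_on X (\<lambda>s. u (f s))" if "continuous_on X f" for X f
    by (rule continuous_on_compose2[OF u that]) auto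
  have "integral {\<theta>..\<theta>+t} u = integral {0..t} (\<lambda>s. u (\<theta> + s))"
    using integral_shift_real_ivl[of \<theta> \<theta> "\<theta>+t" u] by (simp add: add.commute)
  moreover have "integral {\<theta>-t..\<theta>} u = integral {0..t} (\<lambda>s. u (\<theta> - s))"
  proof -
    have "integral {\<theta>-t..\<theta>} u = integral {-t..0} (\<lambda>s. u (\<theta> + s))"
      using integral_shift_real_ivl[of "\<theta>-t" \<theta> \<theta> u] by (simp add: add.commute)
    also have "\<dots> = integral {0..t} (\<lambda>s. u (\<theta> - s))"
      using Henstock_Kurzweil_Integration.integral_reflect_real[of t 0 "\<lambda>s. u (\<theta> - s)"] by simp
    finally show ?thesis .
  qed
  moreover have "integral {\<theta>-t..\<theta>+t} u = integral {\<theta>-t..\<theta>} u + integral {\<theta>..\<theta>+t} u"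
    using t by (intro Henstock_Kurzweil_Integration.integral_combine[symmetric]
    integrable_continuous_interval continuous_on_subset[OF u]) auto
  moreover have "integral {0..t} (\<lambda>s. u (\<theta> + s) + u (\<theta> - s)) =
    integral {0..t} (\<lambda>s. u (\<theta> + s)) + integral {0..t} (\<lambda>s. u (\<theta> - s))"
    by (intro Henstock_Kurzweil_Integration.integral_add integrable_continuous_interval c
    continuous_intros)
  ultimately show ?thesis by simp
qed

text \<open>
  A centred interval of radius at most \<open>pi\<close> around a point of \<open>{0..2*pi}\<close> need not lie in
  \<open>{0..2*pi}\<close>, but it lies in the three periods considered here.
\<close>
lemma integral_three_periods:
  fixes u :: "real \<Rightarrow> real"
  assumes u: "continuous_on UNIV u" and per: "\<And>x. u (x + p) = u x" and p: "0 \<le> p"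
  shows "integral {-p..2*p} u = 3 * integral {0..p} u"
proof -
  have i: "u integrable_on {a..b}" for a b
    by (intro integrable_continuous_interval continuous_on_subset[OF u]) auto
  have "integral {-p..2*p} u = integral {-p..0} u + integral {0..2*p} u"
    using p i by (intro Henstock_Kurzweil_Integration.integral_combine[symmetric]) auto
  also have "integral {0..2*p} u = integral {0..p} u + integral {p..2*p} u"
    using p i by (intro Henstock_Kurzweil_Integration.integral_combine[symmetric]) auto
  also have "integral {p..2*p} u = integral {0..p} u"
    using integral_shift_real_ivl[of p p "2*p" u] by (simp add: per)
  also have "integral {-p..0} u = integral {0..p} u"
    using integral_shift_real_ivl[of 0 p p u] by (simp add: per)
  finally show ?thesis by simp
qed

text \<open>
  The set where the radial maximal function of \<open>h\<close>, taken over radii below \<open>R\<close>, exceeds \<open>\<mu>\<close>.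
\<close>
definition radial_exceedance :: "(complex \<Rightarrow> complex) \<Rightarrow> real \<Rightarrow> real \<Rightarrow> real set" where
  "radial_exceedance h R \<mu> = {\<theta>\<in>{0..2*pi}. \<exists>r\<in>{0..<R}. \<mu> < norm (h (of_real r * cis \<theta>))}"

lemma radial_exceedance_mono: "R \<le> R' \<Longrightarrow> radial_exceedance h R \<mu> \<subseteq> radial_exceedance h R' \<mu>"
  unfolding radial_exceedance_def by fastforce

lemma lmeasurable_radial_exceedance:
  assumes h: "h holomorphic_on ball 0 R"
  shows "radial_exceedance h R \<mu> \<in> lmeasurable"
proof -
  have "open {\<theta>. \<mu> < norm (h (of_real r * cis \<theta>))}" if "r \<in> {0..<R}" for r
  proof -
    have "continuous_on UNIV (\<lambda>\<theta>. h (of_real r * cis \<theta>))"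
      by (rule continuous_on_compose2[OF holomorphic_on_imp_continuous_on[OF h]])
         (use that in \<open>auto intro!: continuous_intros simp: norm_mult\<close>)
    then show ?thesis by (intro open_Collect_less continuous_intros)
  qed
  then have "open (\<Union>r\<in>{0..<R}. {\<theta>. \<mu> < norm (h (of_real r * cis \<theta>))})" by auto
  then have "{0..2*pi} \<inter> (\<Union>r\<in>{0..<R}. {\<theta>. \<mu> < norm (h (of_real r * cis \<theta>))}) \<in> lmeasurable"
    by (intro fmeasurable_Int_fmeasurable) auto
  moreover have "radial_exceedance h R \<mu> =
    {0..2*pi} \<inter> (\<Union>r\<in>{0..<R}. {\<theta>. \<mu> < norm (h (of_real r * cis \<theta>))})"
    by (auto simp: radial_exceedance_def)
  ultimately show ?thesis by simp
qed

text \<open>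
  If \<open>\<bar>h\<bar>\<close> exceeds \<open>\<mu>\<close> somewhere on the radius at \<open>\<theta>\<close>, then by \<open>norm_le_of_circle_averages_le\<close>
  some centred interval around \<open>\<theta>\<close> has average above \<open>\<mu>\<close>, so the covering bound applies.
\<close>
lemma measure_radial_exceedance_circle:
  assumes h: "h holomorphic_on ball 0 \<rho>" "1 < \<rho>" and \<mu>: "0 < \<mu>"
  shows "measure lebesgue (radial_exceedance h 1 \<mu>) \<le>
    15 / \<mu> * integral {0..2*pi} (\<lambda>t. norm (h (cis t)))"
proof -
  define u where "u t = norm (h (cis t))" for t
  have u: "continuous_on UNIV u" unfolding u_def
    by (intro continuous_on_norm continuous_on_compose2[OF holomorphic_on_imp_continuous_on[OF
    h(1)]])
       (use h in \<open>auto intro!: continuous_intros\<close>)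
  have per: "u (x + 2 * pi) = u x" for x by (simp add: u_def cis_mult[symmetric])
  obtain T where T: "radial_exceedance h 1 \<mu> \<subseteq> T" "T \<in> lmeasurable"
       "measure lebesgue T \<le> 10 / (2 * \<mu>) * integral {-(2*pi)..2*(2*pi)} u"
  proof (rule centred_maximal_covering[where u = u and \<mu> = "2 * \<mu>" and E =
    "radial_exceedance h 1 \<mu>"])
    fix \<theta> assume \<theta>: "\<theta> \<in> radial_exceedance h 1 \<mu>"
    then obtain r where r: "0 \<le> r" "r < 1" "\<mu> < norm (h (of_real r * cis \<theta>))"
      by (auto simp: radial_exceedance_def)
    with norm_le_of_circle_averages_le[OF h r(1,2), of \<theta> \<mu>]
    obtain t where t: "t \<in> {0..pi}" "2 * \<mu> * t < integral {0..t} (\<lambda>s. u (\<theta> + s) + u (\<theta> - s))"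
      unfolding u_def by (meson not_le)
    then have "t \<noteq> 0" by (intro notI) simp
    with t have "0 < t" "2 * \<mu> * t < integral {\<theta>-t..\<theta>+t} u" "{\<theta>-t..\<theta>+t} \<subseteq> {-(2*pi)..2*(2*pi)}"
      using integral_symmetric_interval[OF u, of t \<theta>] \<theta> by (auto simp: radial_exceedance_def)
    then show "\<exists>t>0. {\<theta>-t..\<theta>+t} \<subseteq> {-(2*pi)..2*(2*pi)} \<and> 2 * \<mu> * t < integral {\<theta>-t..\<theta>+t} u" by blast
  qed (use \<mu> continuous_on_subset[OF u] in \<open>auto simp: u_def\<close>)
  have "radial_exceedance h 1 \<mu> \<in> sets lebesgue"
    using h by (intro fmeasurableD lmeasurable_radial_exceedance holomorphic_on_subset[OF h(1)])
    auto
  then have "measure lebesgue (radial_exceedance h 1 \<mu>) \<le> measure lebesgue T"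
    using T by (intro measure_mono_fmeasurable) auto
  also note T(3)
  finally show ?thesis using integral_three_periods[OF u per] by (simp add: u_def[abs_def])
qed

text \<open>
  For a function that is only holomorphic in the open disk, the previous bound applies to the
  dilates \<open>G (R z)\<close> with \<open>R < 1\<close>; the exceedance sets increase to the one of \<open>G\<close> as \<open>R\<close> tends to
  \<open>1\<close>.
\<close>
lemma measure_radial_exceedance:
  assumes G: "G holomorphic_on ball 0 1" and \<mu>: "0 < \<mu>"
    and K: "\<And>R. R \<in> {0..<1} \<Longrightarrow> integral {0..2*pi} (\<lambda>t. norm (G (of_real R * cis t))) \<le> K"
  shows "measure lebesgue (radial_exceedance G 1 \<mu>) \<le> 15 / \<mu> * K"
proof -
  define R where "R k = 1 - 1 / (real k + 2)" for k :: nat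
  have R: "0 < R k" "R k < 1" for k by (auto simp: R_def field_simps)
  have Rm: "R i \<le> R j" if "i \<le> j" for i j using that by (simp add: R_def frac_le)
  have ex: "radial_exceedance G (R k) \<mu> \<in> lmeasurable" for k
    using R[of k] by (intro lmeasurable_radial_exceedance holomorphic_on_subset[OF G]) auto
  have le: "measure lebesgue (radial_exceedance G (R k) \<mu>) \<le> 15 / \<mu> * K" for k
  proof -
    have "(\<lambda>z. G (of_real (R k) * z)) holomorphic_on ball 0 (1 / R k)"
      by (rule holomorphic_on_compose_gen[OF _ G, unfolded o_def])
         (use R[of k] in \<open>auto intro!: holomorphic_intros simp: norm_mult field_simps\<close>)
    from measure_radial_exceedance_circle[OF this _ \<mu>]
    have "measure lebesgue (radial_exceedance (\<lambda>z. G (of_real (R k) * z)) 1 \<mu>)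
        \<le> 15 / \<mu> * integral {0..2*pi} (\<lambda>t. norm (G (of_real (R k) * cis t)))"
      using R[of k] by simp
    also have "\<dots> \<le> 15 / \<mu> * K" using \<mu> R[of k] by (intro mult_left_mono K) auto
    also have "radial_exceedance (\<lambda>z. G (of_real (R k) * z)) 1 \<mu> = radial_exceedance G (R k) \<mu>"
    proof -
      have "(\<exists>r\<in>{0..<1}. \<mu> < norm (G (of_real (R k) * (of_real r * cis \<theta>)))) \<longleftrightarrow>
            (\<exists>r\<in>{0..<R k}. \<mu> < norm (G (of_real r * cis \<theta>)))" (is "?L \<longleftrightarrow> ?R") for \<theta>
      proof
        assume ?L
        then obtain r where "r \<in> {0..<1}" "\<mu> < norm (G (of_real (R k) * (of_real r * cis \<theta>)))"
          by auto
        then show ?R using R[of k] by (intro bexI[of _ "R k * r"]) (auto simp: mult.assoc)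
      next
        assume ?R
        then obtain r where "r \<in> {0..<R k}" "\<mu> < norm (G (of_real r * cis \<theta>))" by auto
        then show ?L using R[of k] by (intro bexI[of _ "r / R k"]) (auto simp: mult.assoc)
      qed
      then show ?thesis by (simp add: radial_exceedance_def)
    qed
    finally show ?thesis .
  qed
  have "measure lebesgue (\<Union>k. radial_exceedance G (R k) \<mu>) \<le> 15 / \<mu> * K"
  proof (rule measure_countable_Union_le[OF ex])
    fix n
    have "(\<Union>i\<le>n. radial_exceedance G (R i) \<mu>) = radial_exceedance G (R n) \<mu>"
      using radial_exceedance_mono[OF Rm, of _ n G \<mu>] by blast
    then show "measure lebesgue (\<Union>i\<le>n. radial_exceedance G (R i) \<mu>) \<le> 15 / \<mu> * K" using le by simp
  qed
  also have "(\<Union>k. radial_exceedance G (R k) \<mu>) = radial_exceedance G 1 \<mu>"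
  proof (intro subset_antisym subsetI)
    fix \<theta> assume "\<theta> \<in> radial_exceedance G 1 \<mu>"
    then obtain r where r: "\<theta> \<in> {0..2*pi}" "r \<in> {0..<1}" "\<mu> < norm (G (of_real r * cis \<theta>))"
      by (auto simp: radial_exceedance_def)
    obtain k :: nat where "1 / (1 - r) < k" using reals_Archimedean2 by blast
    then have "1 < real k * (1 - r)" using r(2) by (simp add: divide_less_eq)
    also have "\<dots> \<le> (real k + 2) * (1 - r)" using r(2) by (intro mult_right_mono) auto
    finally have "1 / (real k + 2) < 1 - r" by (simp add: divide_less_eq mult.commute)
    then have "r < R k" by (simp add: R_def)
    with r have "\<theta> \<in> radial_exceedance G (R k) \<mu>"
      by (auto simp: radial_exceedance_def intro!: bexI[of _ r])
    then show "\<theta> \<in> (\<Union>k. radial_exceedance G (R k) \<mu>)" by blast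
  qed (use radial_exceedance_mono[OF less_imp_le[OF R(2)]] in blast)
  finally show ?thesis .
qed

section \<open>Square means on circles\<close>

lemma parseval_radius:
  assumes F: "F holomorphic_on ball 0 1" and R: "0 \<le> R" "R < 1"
  shows "(\<lambda>n. (norm (taylor_coeff F n) * R ^ n)\<^sup>2) sums
           (integral {0..2*pi} (\<lambda>t. (norm (F (of_real R * cis t)))\<^sup>2) / (2 * pi))"
proof -
  define a where "a n = taylor_coeff F n * of_real R ^ n" for n
  have a: "summable (\<lambda>n. norm (a n))"
    using summable_norm_taylor[OF F R] R by (simp add: a_def norm_mult norm_power)
  have c: "circle_series a t = F (of_real R * cis t)" for t
    using taylor_sums[OF F, of "of_real R * cis t"] R
    by (simp add: circle_series_def a_def sums_iff norm_mult power_mult_distrib mult_ac)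
  have cont: "continuous_on {0..2*pi} (\<lambda>t. F (of_real R * cis t))"
    using continuous_on_circle_series[OF a] unfolding c[abs_def] .
  have i: "(\<lambda>t. (norm (F (of_real R * cis t)))\<^sup>2) integrable_on {0..2*pi}"
    by (intro integrable_continuous_interval continuous_intros cont)
  have "(\<lambda>n. a n * cnj (a n)) sums
     (integral {0..2*pi} (\<lambda>t. F (of_real R * cis t) * cnj (F (of_real R * cis t))) / (2 * pi))"
    using parseval_circle_series[OF a a] by (simp add: c)
  also have "(\<lambda>n. a n * cnj (a n)) = (\<lambda>n. complex_of_real ((norm (taylor_coeff F n) * R ^ n)\<^sup>2))"
    using R by (simp only: complex_norm_square[symmetric]) (simp add: a_def norm_mult norm_power)
  also have "integral {0..2*pi} (\<lambda>t. F (of_real R * cis t) * cnj (F (of_real R * cis t))) =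
      of_real (integral {0..2*pi} (\<lambda>t. (norm (F (of_real R * cis t)))\<^sup>2))"
    unfolding complex_norm_square[symmetric]
    using integral_linear[OF i bounded_linear_of_real[where 'a = complex]] by (simp add: o_def)
  also have "of_real (integral {0..2*pi} (\<lambda>t. (norm (F (of_real R *
    cis t)))\<^sup>2)) / complex_of_real (2 * pi) =
     complex_of_real (integral {0..2*pi} (\<lambda>t. (norm (F (of_real R * cis t)))\<^sup>2) / (2 * pi))" by simp
  finally show ?thesis unfolding sums_of_real_iff .
qed

lemma integral_circle_norm_square_le:
  assumes F: "F holomorphic_on ball 0 1" and s: "summable (\<lambda>n. (norm (taylor_coeff F n))\<^sup>2)"
    and R: "0 \<le> R" "R < 1"
  shows "integral {0..2*pi} (\<lambda>t. (norm (F (of_real R * cis t)))\<^sup>2)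
           \<le> 2 * pi * (\<Sum>n. (norm (taylor_coeff F n))\<^sup>2)"
proof -
  have "integral {0..2*pi} (\<lambda>t. (norm (F (of_real R * cis t)))\<^sup>2) / (2 * pi) =
    (\<Sum>n. (norm (taylor_coeff F n) * R ^ n)\<^sup>2)"
    using parseval_radius[OF F R] by (simp add: sums_iff)
  also have "\<dots> \<le> (\<Sum>n. (norm (taylor_coeff F n))\<^sup>2)"
  proof (rule suminf_le)
    show "(norm (taylor_coeff F n) * R ^ n)\<^sup>2 \<le> (norm (taylor_coeff F n))\<^sup>2" for n
      using R by (intro power_mono mult_left_le power_le_one) auto
    show "summable (\<lambda>n. (norm (taylor_coeff F n) * R ^ n)\<^sup>2)"
      using parseval_radius[OF F R] by (simp add: sums_iff)
  qed (rule s)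
  finally show ?thesis by (simp add: field_simps)
qed

text \<open>
  Parseval's identity on circles of radius \<open>R < 1\<close> bounds the partial sums of the weighted
  squares by the supremum of \<open>\<bar>\<phi>\<bar>\<^sup>2\<close>; then \<open>R\<close> tends to \<open>1\<close> in each finite partial sum.
\<close>
lemma Hinf_subset_H2:
  assumes "\<phi> \<in> Hinf"
  shows "\<phi> \<in> H2"
proof -
  have hol: "\<phi> holomorphic_on ball 0 1" using assms by (simp add: Hinf_def)
  obtain C where C: "\<And>z. z \<in> ball 0 1 \<Longrightarrow> norm (\<phi> z) \<le> C"
    using assms by (force simp: Hinf_def bounded_iff)
  have "0 \<le> C" using C[of 0] by (smt (verit) norm_ge_zero centre_in_ball)
  have le: "(\<Sum>n<N. (norm (taylor_coeff \<phi> n) * R ^ n)\<^sup>2) \<le> C\<^sup>2" if R: "R \<in> {0..<1}" for N R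
  proof -
    have "(\<Sum>n<N. (norm (taylor_coeff \<phi> n) * R ^ n)\<^sup>2) \<le> (\<Sum>n. (norm (taylor_coeff \<phi> n) * R ^ n)\<^sup>2)"
      using parseval_radius[OF hol, of R] R by (intro sum_le_suminf) (auto simp: sums_iff)
    also have "\<dots> = integral {0..2*pi} (\<lambda>t. (norm (\<phi> (of_real R * cis t)))\<^sup>2) / (2 * pi)"
      using parseval_radius[OF hol, of R] R by (simp add: sums_iff)
    also have "integral {0..2*pi} (\<lambda>t. (norm (\<phi> (of_real R * cis t)))\<^sup>2) \<le>
      integral {0..2*pi} (\<lambda>t. C\<^sup>2)"
    proof (rule integral_le)
      have "continuous_on {0..2*pi} (\<lambda>t. \<phi> (of_real R * cis t))"
        by (rule continuous_on_compose2[OF holomorphic_on_imp_continuous_on[OF hol]])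
           (use R in \<open>auto intro!: continuous_intros simp: norm_mult\<close>)
      then show "(\<lambda>t. (norm (\<phi> (of_real R * cis t)))\<^sup>2) integrable_on {0..2*pi}"
        by (intro integrable_continuous_interval continuous_intros)
      show "(norm (\<phi> (of_real R * cis t)))\<^sup>2 \<le> C\<^sup>2" for t
        using R by (intro power_mono C) (auto simp: norm_mult)
    qed auto
    finally show ?thesis by (simp add: divide_right_mono)
  qed
  have "(\<Sum>n<N. (norm (taylor_coeff \<phi> n))\<^sup>2) \<le> C\<^sup>2" for N
  proof (rule tendsto_upperbound)
    show "((\<lambda>R. \<Sum>n<N. (norm (taylor_coeff \<phi> n) * R ^ n)\<^sup>2) \<longlongrightarrow>
      (\<Sum>n<N. (norm (taylor_coeff \<phi> n))\<^sup>2)) (at_left (1::real))"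
      by (auto intro!: tendsto_eq_intros)
    have "\<forall>\<^sub>F R in at_left (1::real). R \<in> {0<..<1}" by (rule eventually_at_left_real) simp
    then show "\<forall>\<^sub>F R in at_left (1::real). (\<Sum>n<N. (norm (taylor_coeff \<phi> n) * R ^ n)\<^sup>2) \<le> C\<^sup>2"
      by eventually_elim (rule le, simp)
  qed simp
  then have "summable (\<lambda>n. (norm (taylor_coeff \<phi> n))\<^sup>2)"
    by (intro summableI_nonneg_bounded) auto
  with hol show ?thesis by (simp add: H2_def)
qed

section \<open>Dilates and radial limits\<close>

text \<open>
  The squared \<open>H2\<close> norm of the difference between \<open>F\<close> and its dilate \<open>F (\<rho> z)\<close>.
\<close>
definition dilation_defect :: "(complex \<Rightarrow> complex) \<Rightarrow> real \<Rightarrow> real" where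
  "dilation_defect F \<rho> = (\<Sum>n. (norm (taylor_coeff F n) * (1 - \<rho> ^ n))\<^sup>2)"

lemma tendsto_dilation_defect:
  assumes "F \<in> H2"
  shows "(dilation_defect F \<longlongrightarrow> 0) (at_left 1)"
proof -
  define a where "a n \<rho> = (norm (taylor_coeff F n) * (1 - \<rho> ^ n))\<^sup>2" for n and \<rho> :: real
  have ev: "\<forall>\<^sub>F \<rho> in at_left (1::real). \<rho> \<in> {0<..<1}" by (rule eventually_at_left_real) simp
  have "((\<lambda>\<rho>. \<Sum>n. a n \<rho>) \<longlongrightarrow> (\<Sum>n::nat. 0)) (at_left 1)"
  proof (rule tannerys_theorem[THEN conjunct2, THEN conjunct2])
    show "summable (\<lambda>n. (norm (taylor_coeff F n))\<^sup>2)" using assms by (simp add: H2_def)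
    show "((\<lambda>\<rho>. a k \<rho>) \<longlongrightarrow> 0) (at_left 1)" for k
      unfolding a_def by (auto intro!: tendsto_eq_intros)
    show "\<forall>\<^sub>F (k, \<rho>) in at_top \<times>\<^sub>F at_left 1. norm (a k \<rho>) \<le> (norm (taylor_coeff F k))\<^sup>2"
      unfolding eventually_prod_filter
    proof (intro exI conjI allI impI)
      show "\<forall>\<^sub>F k in at_top. True" by simp
      show "\<forall>\<^sub>F \<rho> in at_left (1::real). \<rho> \<in> {0<..<1}" by (rule ev)
      fix k :: nat and \<rho> :: real assume "\<rho> \<in> {0<..<1}"
      then have "0 \<le> 1 - \<rho> ^ k" "1 - \<rho> ^ k \<le> 1" by (auto intro: power_le_one)
      then have "(norm (taylor_coeff F k) * (1 - \<rho> ^ k))\<^sup>2 \<le> (norm (taylor_coeff F k))\<^sup>2"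
        by (intro power_mono mult_left_le) auto
      then show "case (k, \<rho>) of (k, \<rho>) \<Rightarrow> norm (a k \<rho>) \<le> (norm (taylor_coeff F k))\<^sup>2"
        by (simp add: a_def)
    qed
  qed simp
  then show ?thesis by (simp add: a_def dilation_defect_def[abs_def])
qed

lemma
  assumes F: "F \<in> H2" and \<rho>: "0 \<le> \<rho>" "\<rho> < 1"
  shows holomorphic_dilation_difference: "(\<lambda>z. F z - F (of_real \<rho> *
    z)) holomorphic_on ball 0 1" (is ?hol)
    and integral_dilation_difference_le: "R \<in> {0..<1} \<Longrightarrow>
      integral {0..2*pi} (\<lambda>t. (norm (F (of_real R * cis t) - F (of_real \<rho> * (of_real R *
        cis t))))\<^sup>2)
           \<le> 2 * pi * dilation_defect F \<rho>"
proof -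
  define D where "D z = F z - F (of_real \<rho> * z)" for z
  have hol: "F holomorphic_on ball 0 1" and s: "summable (\<lambda>n. (norm (taylor_coeff F n))\<^sup>2)"
    using F by (auto simp: H2_def)
  have in1: "norm (of_real \<rho> * z) < 1" if "norm z < 1" for z :: complex
  proof -
    have "norm (of_real \<rho> * z) \<le> 1 * norm z"
      unfolding norm_mult using \<rho> by (intro mult_right_mono) auto
    with that show ?thesis by simp
  qed
  have "(\<lambda>z. F (of_real \<rho> * z)) holomorphic_on ball 0 1"
    by (rule holomorphic_on_compose_gen[OF _ hol, unfolded o_def])
       (use in1 in \<open>auto intro!: holomorphic_intros\<close>)
  then have D: "D holomorphic_on ball 0 1" unfolding D_def[abs_def]
    by (intro holomorphic_intros hol)
  then show ?hol by (simp add: D_def[abs_def])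
  have "taylor_coeff D n = taylor_coeff F n * of_real (1 - \<rho> ^ n)" for n
  proof (rule taylor_coeff_unique[of 1])
    fix z :: complex assume z: "norm z < 1"
    from sums_diff[OF taylor_sums[OF hol z] taylor_sums[OF hol in1[OF z]]]
    show "(\<lambda>n. taylor_coeff F n * of_real (1 - \<rho> ^ n) * z ^ n) sums D z"
      by (simp add: D_def power_mult_distrib algebra_simps)
  qed simp
  then have nD: "norm (taylor_coeff D n) = norm (taylor_coeff F n) * (1 - \<rho> ^ n)" for n
    using power_le_one[of \<rho> n] \<rho> by (simp add: norm_mult del: of_real_diff)
  have "summable (\<lambda>n. (norm (taylor_coeff D n))\<^sup>2)"
  proof (rule summable_comparison_test'[OF s])
    show "norm ((norm (taylor_coeff D n))\<^sup>2) \<le> (norm (taylor_coeff F n))\<^sup>2" for n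
      using power_le_one[of \<rho> n] \<rho> unfolding nD by (auto intro!: power_mono mult_left_le)
  qed
  from integral_circle_norm_square_le[OF D this, of R]
  show "integral {0..2*pi} (\<lambda>t. (norm (F (of_real R * cis t) - F (of_real \<rho> * (of_real R *
    cis t))))\<^sup>2)
           \<le> 2 * pi * dilation_defect F \<rho>" if "R \<in> {0..<1}"
    using that by (simp add: dilation_defect_def nD) (simp add: D_def)
qed

text \<open>
  The weak-type bound is linear in an integral of the modulus. Applied to the square of a
  holomorphic function it becomes a bound in terms of the \<open>H2\<close> norm.
\<close>
lemma measure_exceedance_dilation_difference:
  assumes F: "F \<in> H2" and \<rho>: "0 \<le> \<rho>" "\<rho> < 1" and \<mu>: "0 < \<mu>"
  shows "measure lebesgue (radial_exceedance (\<lambda>z. F z - F (of_real \<rho> * z)) 1 \<mu>) \<le>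
    30 * pi / \<mu>\<^sup>2 * dilation_defect F \<rho>"
proof -
  have "radial_exceedance (\<lambda>z. F z - F (of_real \<rho> * z)) 1 \<mu> =
    radial_exceedance (\<lambda>z. (F z - F (of_real \<rho> * z))\<^sup>2) 1 (\<mu>\<^sup>2)"
  proof -
    have "\<mu>\<^sup>2 < (norm w)\<^sup>2 \<longleftrightarrow> \<mu> < norm w" for w :: complex
      using \<mu> by (meson less_imp_le norm_ge_zero power2_less_imp_less power_strict_mono pos2)
    then show ?thesis by (simp add: radial_exceedance_def norm_power)
  qed
  moreover have "measure lebesgue (radial_exceedance (\<lambda>z. (F z - F (of_real \<rho> * z))\<^sup>2) 1 (\<mu>\<^sup>2)) \<le>
    15 / \<mu>\<^sup>2 * (2 * pi * dilation_defect F \<rho>)"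
    using integral_dilation_difference_le[OF F \<rho>] \<mu>
    by (intro measure_radial_exceedance[OF holomorphic_on_power[OF
    holomorphic_dilation_difference[OF F \<rho>]]])
       (auto simp: norm_power)
  ultimately show ?thesis by simp
qed

text \<open>
  The values of \<open>f\<close> are eventually within \<open>2 * e\<close> of each other, for every \<open>e\<close>, so completeness
  applies.
\<close>
lemma tendsto_if_approx_constants:
  fixes f :: "'a \<Rightarrow> complex"
  assumes "\<And>e. 0 < e \<Longrightarrow> \<exists>c. \<forall>\<^sub>F x in F. dist (f x) c < e" and "F \<noteq> bot"
  shows "\<exists>L. (f \<longlongrightarrow> L) F"
proof -
  have "cauchy_filter (filtermap f F)"
    unfolding cauchy_filter_metric_filtermap
  proof (intro allI impI)
    fix e :: real assume "0 < e"
    then obtain c where "\<forall>\<^sub>F x in F. dist (f x) c < e / 2" using assms(1)[of "e/2"] by auto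
    then show "\<exists>P. eventually P F \<and> (\<forall>x y. P x \<and> P y \<longrightarrow> dist (f x) (f y) < e)"
      by (intro exI[of _ "\<lambda>x. dist (f x) c < e / 2"]) (auto intro: dist_triangle_half_r
      dist_triangle_half_l)
  qed
  moreover have "complete (UNIV :: complex set)" by (rule complete_UNIV)
  ultimately show ?thesis
    using complete_uniform[where S="UNIV :: complex set"] assms(2)
    by (force simp add: filterlim_def filtermap_bot_iff)
qed

text \<open>
  Fatou's theorem for \<open>H2\<close>. The dilate \<open>F (\<rho> z)\<close> is continuous up to the circle, so wherever the
  radial maximal function of \<open>F z - F (\<rho> z)\<close> is small, the values of \<open>F\<close> near the end of the
  radius are close to the constant \<open>F (\<rho> cis \<theta>)\<close>. The exceptional set has small measure when \<open>\<rho>\<close>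
  is near \<open>1\<close>, for any fixed tolerance.
\<close>
theorem H2_radial_limits:
  assumes F: "F \<in> H2"
  shows "negligible {\<theta>\<in>{0..2*pi}. \<not> (\<exists>L. ((\<lambda>r. F (of_real r * cis \<theta>)) \<longlongrightarrow> L) (at_left (1::real)))}"
proof -
  have hol: "F holomorphic_on ball 0 1" using F by (simp add: H2_def)
  define N where "N m = {\<theta>\<in>{0..2*pi}. \<forall>c. \<not> (\<forall>\<^sub>F r in at_left (1::real). dist (F (of_real r *
    cis \<theta>)) c < 1 / real (Suc m))}" for m
  have "negligible (N m)" for m
    unfolding negligible_outer_le
  proof (intro allI impI)
    fix e :: real assume e: "0 < e"
    \<comment> \<open>Half of the tolerance is spent on \<open>F z - F (\<rho> z)\<close>, half on the continuity of the dilate.\<close>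
    define \<mu> where "\<mu> = 1 / (2 * real (Suc m))"
    have \<mu>: "0 < \<mu>" by (simp add: \<mu>_def)
    have "((\<lambda>\<rho>. 30 * pi / \<mu>\<^sup>2 * dilation_defect F \<rho>) \<longlongrightarrow> 30 * pi / \<mu>\<^sup>2 * 0) (at_left 1)"
      by (intro tendsto_intros tendsto_dilation_defect F)
    then have "\<forall>\<^sub>F \<rho> in at_left 1. 30 * pi / \<mu>\<^sup>2 * dilation_defect F \<rho> < e"
      using e by (intro order_tendstoD(2)[of _ "30 * pi / \<mu>\<^sup>2 * 0"]) auto
    moreover have "\<forall>\<^sub>F \<rho> in at_left (1::real). \<rho> \<in> {0<..<1}" by (rule eventually_at_left_real) simp
    ultimately have "\<forall>\<^sub>F \<rho> in at_left 1. 30 * pi / \<mu>\<^sup>2 * dilation_defect F \<rho> < e \<and> \<rho> \<in> {0<..<1}"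
      by (rule eventually_conj)
    then obtain \<rho> where \<rho>: "30 * pi / \<mu>\<^sup>2 * dilation_defect F \<rho> < e" "0 < \<rho>" "\<rho> < 1"
      using eventually_happens'[OF trivial_limit_at_left_real] by fastforce
    define T where "T = radial_exceedance (\<lambda>z. F z - F (of_real \<rho> * z)) 1 \<mu>"
    have "N m \<subseteq> T"
    proof (rule ccontr)
      assume "\<not> N m \<subseteq> T"
      then obtain \<theta> where \<theta>: "\<theta> \<in> N m" "\<theta> \<notin> T" by auto
      have le: "norm (F (of_real r * cis \<theta>) - F (of_real \<rho> * (of_real r * cis \<theta>))) \<le> \<mu>"
        if "r \<in> {0<..<1}" for r
        using \<theta> that by (auto simp: N_def T_def radial_exceedance_def not_less)
      have "isCont F (of_real \<rho> * cis \<theta>)"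
        using holomorphic_on_imp_continuous_on[OF hol] \<rho>
        by (subst (asm) continuous_on_eq_continuous_at) (auto simp: norm_mult)
      then have "((\<lambda>r. F (of_real \<rho> * (of_real r * cis \<theta>))) \<longlongrightarrow>
        F (of_real \<rho> * cis \<theta>)) (at_left (1::real))"
        by (rule isCont_tendsto_compose) (auto intro!: tendsto_eq_intros)
      from tendstoD[OF this \<mu>]
      have "\<forall>\<^sub>F r in at_left (1::real). dist (F (of_real \<rho> * (of_real r * cis \<theta>))) (F (of_real \<rho> *
        cis \<theta>)) < \<mu>" .
      moreover have "\<forall>\<^sub>F r in at_left (1::real). r \<in> {0<..<1}"
        by (rule eventually_at_left_real) simp
      ultimately have "\<forall>\<^sub>F r in at_left (1::real). dist (F (of_real r * cis \<theta>)) (F (of_real \<rho> *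
        cis \<theta>)) < 1 / real (Suc m)"
      proof eventually_elim
        case (elim r)
        have "2 * \<mu> = 1 / real (Suc m)" by (simp add: \<mu>_def field_simps)
        moreover have "dist (F (of_real r * cis \<theta>)) (F (of_real \<rho> * (of_real r * cis \<theta>))) \<le> \<mu>"
          using le[OF elim(2)] by (simp add: dist_norm)
        ultimately show ?case using elim(1)
           dist_triangle[of "F (of_real r * cis \<theta>)" "F (of_real \<rho> * cis \<theta>)" "F (of_real \<rho> *
             (of_real r * cis \<theta>))"] by linarith
      qed
      then show False using \<theta>(1) by (auto simp: N_def)
    qed
    moreover have "T \<in> lmeasurable"
      unfolding T_def using holomorphic_dilation_difference[OF F] \<rho>
      by (intro lmeasurable_radial_exceedance) auto
    moreover have "measure lebesgue T \<le> e"
      using measure_exceedance_dilation_difference[OF F, of \<rho> \<mu>] \<rho> \<mu> by (simp add: T_def)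
    ultimately show "\<exists>T. N m \<subseteq> T \<and> T \<in> lmeasurable \<and> measure lebesgue T \<le> e" by blast
  qed
  then have neg: "negligible (\<Union>m. N m)" by (intro negligible_countable_Union) auto
  show ?thesis
  proof (rule negligible_subset[OF neg], rule ccontr)
    assume "\<not> {\<theta>\<in>{0..2*pi}. \<not> (\<exists>L. ((\<lambda>r. F (of_real r * cis \<theta>)) \<longlongrightarrow> L) (at_left (1::real)))} \<subseteq>
      (\<Union>m. N m)"
    then obtain \<theta> where \<theta>: "\<theta> \<in> {0..2*pi}" "\<not> (\<exists>L. ((\<lambda>r. F (of_real r * cis \<theta>)) \<longlongrightarrow>
      L) (at_left (1::real)))" "\<And>m. \<theta> \<notin> N m"
      by blast
    have "\<exists>L. ((\<lambda>r. F (of_real r * cis \<theta>)) \<longlongrightarrow> L) (at_left (1::real))"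
    proof (rule tendsto_if_approx_constants)
      fix e :: real assume "0 < e"
      then obtain m where m: "1 / real (Suc m) < e" using nat_approx_posE by blast
      from \<theta>(1) \<theta>(3)[of m] obtain c where "\<forall>\<^sub>F r in at_left (1::real). dist (F (of_real r *
        cis \<theta>)) c < 1 / real (Suc m)"
        by (auto simp: N_def)
      then show "\<exists>c. \<forall>\<^sub>F r in at_left (1::real). dist (F (of_real r * cis \<theta>)) c < e"
        using m by (intro exI[of _ c]) (auto elim: eventually_mono)
    qed simp
    with \<theta>(2) show False by blast
  qed
qed

section \<open>Boundary values in the mean\<close>

abbreviation circle_measure :: "real measure" where
  "circle_measure \<equiv> lebesgue_on {0..2*pi}"

lemma AE_circle_iff: "(AE \<theta> in circle_measure. P \<theta>) \<longleftrightarrow> negligible {\<theta>\<in>{0..2*pi}. \<not> P \<theta>}"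
proof -
  have "(AE \<theta> in circle_measure. P \<theta>) \<longleftrightarrow> (AE \<theta> in lebesgue. \<theta> \<in> {0..2*pi} \<longrightarrow> P \<theta>)"
    by (rule AE_restrict_space_iff) simp
  also have "\<dots> \<longleftrightarrow> {\<theta>\<in>{0..2*pi}. \<not> P \<theta>} \<in> null_sets lebesgue"
    by (subst completion.AE_iff_null_sets) (auto simp: Collect_neg_eq[symmetric] Int_def)
  finally show ?thesis by (simp add: negligible_iff_null_sets)
qed

lemma AE_tendsto_radial_value:
  assumes "F \<in> H2"
  shows "AE \<theta> in circle_measure. ((\<lambda>r. F (of_real r * cis \<theta>)) \<longlongrightarrow>
    radial_value F \<theta>) (at_left (1::real))"
  unfolding AE_circle_iff
proof (rule negligible_subset[OF H2_radial_limits[OF assms]], safe)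
  fix \<theta> L
  assume "((\<lambda>r. F (of_real r * cis \<theta>)) \<longlongrightarrow> L) (at_left (1::real))"
    and "\<not> ((\<lambda>r. F (of_real r * cis \<theta>)) \<longlongrightarrow> radial_value F \<theta>) (at_left (1::real))"
  moreover from this(1) have "radial_value F \<theta> = L"
    unfolding radial_value_def by (intro tendsto_Lim) auto
  ultimately show False by simp
qed

lemma continuous_on_circle:
  assumes "F holomorphic_on ball 0 1" "0 \<le> R" "R < 1"
  shows "continuous_on X (\<lambda>t. F (of_real R * cis t))"
  by (rule continuous_on_compose2[OF holomorphic_on_imp_continuous_on[OF assms(1)]])
     (use assms in \<open>auto intro!: continuous_intros simp: norm_mult\<close>)

lemma filterlim_radii: "filterlim (\<lambda>k. 1 - 1 / (real k + 2)) (at_left 1) sequentially"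
  by real_asymp

lemma borel_measurable_radial_value:
  assumes F: "F \<in> H2"
  shows "radial_value F \<in> borel_measurable circle_measure"
proof -
  have hol: "F holomorphic_on ball 0 1" using F by (simp add: H2_def)
  define R where "R k = 1 - 1 / (real k + 2)" for k :: nat
  have R: "0 \<le> R k" "R k < 1" for k by (auto simp: R_def field_simps)
  define g where "g \<theta> = lim (\<lambda>k. F (of_real (R k) * cis \<theta>))" for \<theta>
  have g: "g \<in> borel_measurable circle_measure"
    unfolding g_def[abs_def]
    by (intro borel_measurable_lim_metric continuous_imp_measurable_on_sets_lebesgue
    continuous_on_circle hol R) auto
  have ae: "AE \<theta> in circle_measure. g \<theta> = radial_value F \<theta>"
    using AE_tendsto_radial_value[OF F]
  proof eventually_elim
    case (elim \<theta>)
    have "(\<lambda>k. F (of_real (R k) * cis \<theta>)) \<longlonglongrightarrow> radial_value F \<theta>"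
      using filterlim_compose[OF elim filterlim_radii] by (simp add: R_def)
    then show ?case unfolding g_def by (rule limI)
  qed
  have "(\<lambda>\<theta>. if \<theta> \<in> {0..2*pi} then g \<theta> else 0) \<in> borel_measurable lebesgue"
    using g by (subst borel_measurable_if) auto
  moreover have "AE \<theta> in lebesgue. (if \<theta> \<in> {0..2*pi} then g \<theta> else 0) =
    (if \<theta> \<in> {0..2*pi} then radial_value F \<theta> else 0)"
    using ae by (subst (asm) AE_restrict_space_iff) (auto elim: eventually_mono)
  ultimately have "(\<lambda>\<theta>. if \<theta> \<in> {0..2*pi} then radial_value F \<theta> else 0) \<in> borel_measurable lebesgue"
    by (rule borel_measurable_AE)
  then show ?thesis by (subst (asm) borel_measurable_if) auto
qed

text \<open>
  On circles of radius \<open>R < 1\<close> the difference between \<open>F\<close> and its dilate obeys this bound.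
  Fatou's lemma carries it to the boundary values along the radii \<open>1 - 1 / (k + 2)\<close>.
\<close>
lemma nn_integral_radial_value_minus_dilate:
  assumes F: "F \<in> H2" and \<rho>: "0 \<le> \<rho>" "\<rho> < 1"
  shows "(\<integral>\<^sup>+\<theta>. ennreal ((norm (radial_value F \<theta> - F (of_real \<rho> * cis \<theta>)))\<^sup>2) \<partial>circle_measure)
           \<le> ennreal (2 * pi * dilation_defect F \<rho>)"
proof -
  have hol: "F holomorphic_on ball 0 1" using F by (simp add: H2_def)
  define R where "R k = 1 - 1 / (real k + 2)" for k :: nat
  have R: "0 \<le> R k" "R k < 1" for k by (auto simp: R_def field_simps)
  define d where "d k \<theta> = (norm (F (of_real (R k) * cis \<theta>) - F (of_real \<rho> * (of_real (R k) *
    cis \<theta>))))\<^sup>2" for k \<theta>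
  have dc: "continuous_on {0..2*pi} (d k)" for k
    unfolding d_def
    by (intro continuous_on_power continuous_on_norm continuous_on_circle[OF
    holomorphic_dilation_difference[OF F \<rho>] R])
  have di: "integrable circle_measure (d k)" for k
    by (rule continuous_imp_integrable_real[OF dc])
  have le: "(\<integral>\<^sup>+\<theta>. ennreal (d k \<theta>) \<partial>circle_measure) \<le> ennreal (2 * pi * dilation_defect F \<rho>)" for k
  proof -
    have "(\<integral>\<^sup>+\<theta>. ennreal (d k \<theta>) \<partial>circle_measure) = ennreal (integral\<^sup>L circle_measure (d k))"
      by (rule nn_integral_eq_integral[OF di]) (simp add: d_def)
    also have "integral\<^sup>L circle_measure (d k) = integral {0..2*pi} (d k)"
      by (rule lebesgue_integral_eq_integral[OF di]) simp
    finally show ?thesis using integral_dilation_difference_le[OF F \<rho>, of "R k"] R[of k]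
      by (auto intro!: ennreal_leI simp: d_def[abs_def])
  qed
  have "AE \<theta> in circle_measure. ennreal ((norm (radial_value F \<theta> - F (of_real \<rho> * cis \<theta>)))\<^sup>2) =
    liminf (\<lambda>k. ennreal (d k \<theta>))"
    using AE_tendsto_radial_value[OF F]
  proof eventually_elim
    case (elim \<theta>)
    have "isCont F (of_real \<rho> * cis \<theta>)"
      using holomorphic_on_imp_continuous_on[OF hol] \<rho>
      by (subst (asm) continuous_on_eq_continuous_at) (auto simp: norm_mult)
    then have "((\<lambda>r. F (of_real \<rho> * (of_real r * cis \<theta>))) \<longlongrightarrow>
      F (of_real \<rho> * cis \<theta>)) (at_left (1::real))"
      by (rule isCont_tendsto_compose) (auto intro!: tendsto_eq_intros)
    from filterlim_compose[OF tendsto_diff[OF elim this] filterlim_radii]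
    have "(\<lambda>k. d k \<theta>) \<longlonglongrightarrow> (norm (radial_value F \<theta> - F (of_real \<rho> * cis \<theta>)))\<^sup>2"
      unfolding d_def R_def by (intro tendsto_power tendsto_norm)
    then have "(\<lambda>k. ennreal (d k \<theta>)) \<longlonglongrightarrow> ennreal ((norm (radial_value F \<theta> - F (of_real \<rho> *
      cis \<theta>)))\<^sup>2)"
      by (rule tendsto_ennrealI)
    then show ?case by (rule lim_imp_Liminf[symmetric, rotated]) simp
  qed
  then have "(\<integral>\<^sup>+\<theta>. ennreal ((norm (radial_value F \<theta> - F (of_real \<rho> * cis \<theta>)))\<^sup>2) \<partial>circle_measure)
     = (\<integral>\<^sup>+\<theta>. liminf (\<lambda>k. ennreal (d k \<theta>)) \<partial>circle_measure)"
    by (rule nn_integral_cong_AE)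
  also have "\<dots> \<le> liminf (\<lambda>k. \<integral>\<^sup>+\<theta>. ennreal (d k \<theta>) \<partial>circle_measure)"
    by (rule nn_integral_liminf) (use di in auto)
  also have "\<dots> \<le> liminf (\<lambda>k::nat. ennreal (2 * pi * dilation_defect F \<rho>))"
    by (rule Liminf_mono) (use le in auto)
  also have "\<dots> = ennreal (2 * pi * dilation_defect F \<rho>)" by (rule Liminf_const) simp
  finally show ?thesis .
qed

text \<open>
  The inequality \<open>x \<le> \<delta> + x\<^sup>2 / \<delta>\<close>, for \<open>x \<ge> 0\<close> and \<open>\<delta> > 0\<close>, turns the bound on the integral of
  the square into one on the integral of the modulus that is small for suitable \<open>\<delta>\<close> and \<open>\<rho>\<close>.
\<close>
lemma
  assumes F: "F \<in> H2" and \<rho>: "0 \<le> \<rho>" "\<rho> < 1" and \<delta>: "0 < \<delta>"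
  shows integrable_radial_value_minus_dilate:
      "integrable circle_measure (\<lambda>\<theta>. radial_value F \<theta> - F (of_real \<rho> * cis \<theta>))" (is ?i)
    and integral_radial_value_minus_dilate_le:
      "(LINT \<theta>|circle_measure. norm (radial_value F \<theta> - F (of_real \<rho> * cis \<theta>)))
           \<le> 2 * pi * (\<delta> + dilation_defect F \<rho> / \<delta>)" (is ?le)
proof -
  have hol: "F holomorphic_on ball 0 1" using F by (simp add: H2_def)
  define x where "x \<theta> = radial_value F \<theta> - F (of_real \<rho> * cis \<theta>)" for \<theta>
  have [measurable]: "x \<in> borel_measurable circle_measure"
    unfolding x_def[abs_def]
    by (intro borel_measurable_diff borel_measurable_radial_value F
        continuous_imp_measurable_on_sets_lebesgue continuous_on_circle hol \<rho>) auto
  have nonneg: "0 \<le> dilation_defect F \<rho>"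
  proof -
    have "0 \<le> integral {0..2*pi} (\<lambda>t. (norm (F (of_real 0 * cis t) - F (of_real \<rho> * (of_real 0 *
      cis t))))\<^sup>2)"
      by (rule integral_nonneg) auto
    also have "\<dots> \<le> 2 * pi * dilation_defect F \<rho>"
      by (rule integral_dilation_difference_le[OF F \<rho>]) simp
    finally have "0 \<le> 2 * pi * dilation_defect F \<rho>" .
    then show ?thesis by (rule contrapos_pp) (simp add: not_le mult_pos_neg)
  qed
  have pt: "norm (x \<theta>) \<le> \<delta> + (norm (x \<theta>))\<^sup>2 / \<delta>" for \<theta>
  proof (cases "norm (x \<theta>) \<le> \<delta>")
    case False
    then have "norm (x \<theta>) * \<delta> \<le> norm (x \<theta>) * norm (x \<theta>)" by (intro mult_left_mono) auto
    then have "norm (x \<theta>) \<le> (norm (x \<theta>))\<^sup>2 / \<delta>" using \<delta> by (simp add: power2_eq_square field_simps)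
    with \<delta> show ?thesis by simp
  qed (use \<delta> in \<open>simp add: add_increasing2\<close>)
  have "(\<integral>\<^sup>+\<theta>. ennreal (norm (x \<theta>)) \<partial>circle_measure) \<le>
     (\<integral>\<^sup>+\<theta>. ennreal \<delta> + ennreal (1 / \<delta>) * ennreal ((norm (x \<theta>))\<^sup>2) \<partial>circle_measure)"
    using pt \<delta> by (intro nn_integral_mono) (simp add: ennreal_mult[symmetric]
    ennreal_plus[symmetric] del: ennreal_plus)
  also have "\<dots> = ennreal \<delta> * emeasure circle_measure (space circle_measure) +
      ennreal (1 / \<delta>) * (\<integral>\<^sup>+\<theta>. ennreal ((norm (x \<theta>))\<^sup>2) \<partial>circle_measure)"
    by (subst nn_integral_add) (auto simp: nn_integral_cmult)
  also have "emeasure circle_measure (space circle_measure) = ennreal (2 * pi)"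
    by (simp add: emeasure_restrict_space)
  also have "ennreal \<delta> * ennreal (2*pi) +
    ennreal (1 / \<delta>) * (\<integral>\<^sup>+\<theta>. ennreal ((norm (x \<theta>))\<^sup>2) \<partial>circle_measure)
     \<le> ennreal \<delta> * ennreal (2*pi) + ennreal (1 / \<delta>) * ennreal (2 * pi * dilation_defect F \<rho>)"
    using nn_integral_radial_value_minus_dilate[OF F \<rho>]
    by (intro add_left_mono mult_left_mono) (auto simp: x_def)
  also have "\<dots> = ennreal (2 * pi * (\<delta> + dilation_defect F \<rho> / \<delta>))"
    using \<delta> nonneg by (simp add: ennreal_mult[symmetric] ennreal_plus[symmetric] algebra_simps del:
    ennreal_plus)
  finally have fin: "(\<integral>\<^sup>+\<theta>. ennreal (norm (x \<theta>)) \<partial>circle_measure) \<le>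
    ennreal (2 * pi * (\<delta> + dilation_defect F \<rho> / \<delta>))" .
  have i: "integrable circle_measure x"
    by (rule integrableI_bounded) (use le_less_trans[OF fin] in auto)
  then show ?i by (simp add: x_def[abs_def])
  have "ennreal (LINT \<theta>|circle_measure. norm (x \<theta>)) = (\<integral>\<^sup>+\<theta>. ennreal (norm (x \<theta>)) \<partial>circle_measure)"
    by (rule nn_integral_eq_integral[symmetric]) (use i in auto)
  with fin have "ennreal (LINT \<theta>|circle_measure. norm (x \<theta>)) \<le>
    ennreal (2 * pi * (\<delta> + dilation_defect F \<rho> / \<delta>))" by simp
  then show ?le using \<delta> nonneg by (subst (asm) ennreal_le_iff) (auto simp: x_def)
qed

section \<open>The Szego kernel\<close>

definition szego_kernel :: "complex \<Rightarrow> complex \<Rightarrow> complex" where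
  "szego_kernel w z = 1 / (1 - cnj w * z)"

lemma szego_denominator_nonzero: "norm w < 1 \<Longrightarrow> norm z \<le> 1 \<Longrightarrow> 1 - cnj w * z \<noteq> 0"
proof
  assume w: "norm w < 1" "norm z \<le> 1" and "1 - cnj w * z = 0"
  then have "norm (cnj w * z) = 1" by simp
  moreover have "norm (cnj w * z) \<le> norm w * 1" unfolding norm_mult using w
    by (intro mult_mono) auto
  ultimately show False using w by simp
qed

lemma taylor_coeff_szego_kernel:
  assumes "norm w < 1"
  shows "taylor_coeff (szego_kernel w) n = cnj w ^ n"
proof (rule taylor_coeff_unique[of 1])
  fix z :: complex assume "norm z < 1"
  then have "norm (cnj w * z) < 1"
    using assms mult_strict_mono'[of "norm w" 1 "norm z" 1] by (simp add: norm_mult)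
  from geometric_sums[OF this] show "(\<lambda>n. cnj w ^ n * z ^ n) sums szego_kernel w z"
    by (simp add: szego_kernel_def power_mult_distrib)
qed simp

lemma
  assumes w: "norm w < 1"
  shows szego_kernel_in_H2: "szego_kernel w \<in> H2"
    and H2_norm_szego_kernel: "(H2_norm (szego_kernel w))\<^sup>2 = 1 / (1 - (norm w)\<^sup>2)"
proof -
  have w2: "(norm w)\<^sup>2 < 1" using w by (simp add: abs_square_less_1)
  have "(\<lambda>n. (norm (taylor_coeff (szego_kernel w) n))\<^sup>2) = (\<lambda>n. ((norm w)\<^sup>2) ^ n)"
    using taylor_coeff_szego_kernel[OF w]
    by (simp add: norm_power power_mult[symmetric] mult.commute)
  then have s: "(\<lambda>n. (norm (taylor_coeff (szego_kernel w) n))\<^sup>2) sums (1 / (1 - (norm w)\<^sup>2))"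
    using geometric_sums[of "(norm w)\<^sup>2"] w2 by simp
  have "szego_kernel w holomorphic_on ball 0 1"
    unfolding szego_kernel_def[abs_def] using szego_denominator_nonzero[OF w]
    by (intro holomorphic_intros) auto
  with s show "szego_kernel w \<in> H2" by (simp add: H2_def sums_iff)
  show "(H2_norm (szego_kernel w))\<^sup>2 = 1 / (1 - (norm w)\<^sup>2)"
    using s w2 by (simp add: H2_norm_def sums_iff)
qed

lemma radial_value_szego_kernel:
  assumes w: "norm w < 1"
  shows "radial_value (szego_kernel w) \<theta> = szego_kernel w (cis \<theta>)"
  unfolding radial_value_def
proof (rule tendsto_Lim)
  show "((\<lambda>r. szego_kernel w (of_real r * cis \<theta>)) \<longlongrightarrow> szego_kernel w (cis \<theta>)) (at_left (1::real))"
    unfolding szego_kernel_def using szego_denominator_nonzero[OF w, of "cis \<theta>"]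
    by (auto intro!: tendsto_eq_intros)
qed simp

lemma integral_szego_kernel_dilate:
  assumes hol: "F holomorphic_on ball 0 1" and w: "norm w < 1" and \<rho>: "0 \<le> \<rho>" "\<rho> < 1"
  shows "integral {0..2*pi} (\<lambda>t. szego_kernel w (cis t) * cnj (F (of_real \<rho> * cis t))) =
           2 * pi * cnj (F (of_real \<rho> * w))"
proof -
  define b where "b n = taylor_coeff F n * of_real \<rho> ^ n" for n
  have a: "summable (\<lambda>n. norm (cnj w ^ n))" using w by (simp add: norm_power summable_geometric)
  have b: "summable (\<lambda>n. norm (b n))"
    using summable_norm_taylor[OF hol \<rho>] \<rho> by (simp add: b_def norm_mult norm_power)
  have cb: "circle_series b t = F (of_real \<rho> * cis t)" for t
    using taylor_sums[OF hol, of "of_real \<rho> * cis t"] \<rho>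
    by (simp add: circle_series_def b_def sums_iff norm_mult power_mult_distrib mult_ac)
  have ca: "circle_series (\<lambda>n. cnj w ^ n) t = szego_kernel w (cis t)" for t
    using circle_series_geometric[of "cnj w" t] w by (simp add: szego_kernel_def)
  have "norm (of_real \<rho> * w) \<le> 1 * norm w" unfolding norm_mult using \<rho>
    by (intro mult_right_mono) auto
  then have "(\<lambda>n. taylor_coeff F n * (of_real \<rho> * w) ^ n) sums F (of_real \<rho> * w)"
    using w by (intro taylor_sums[OF hol]) simp
  then have "(\<lambda>n. cnj (taylor_coeff F n * (of_real \<rho> * w) ^ n)) sums cnj (F (of_real \<rho> * w))"
    by (simp only: sums_cnj)
  also have "(\<lambda>n. cnj (taylor_coeff F n * (of_real \<rho> * w) ^ n)) = (\<lambda>n. cnj w ^ n * cnj (b n))"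
    by (simp add: b_def power_mult_distrib mult_ac)
  finally have "(\<lambda>n. cnj w ^ n * cnj (b n)) sums cnj (F (of_real \<rho> * w))" .
  with parseval_circle_series[OF a b]
  have "integral {0..2*pi} (\<lambda>t. szego_kernel w (cis t) * cnj (F (of_real \<rho> * cis t))) / (2 * pi) =
    cnj (F (of_real \<rho> * w))"
    unfolding ca cb by (rule sums_unique2)
  then show ?thesis by (simp add: field_simps)
qed

text \<open>
  For the dilates of \<open>F\<close> this is Parseval's identity. Passing to \<open>F\<close> requires that the dilates
  converge to the boundary values in the mean: first \<open>\<rho>\<close> tends to \<open>1\<close>, then \<open>\<delta>\<close> to \<open>0\<close>.
\<close>
theorem H2_inner_szego_kernel:
  assumes F: "F \<in> H2" and w: "norm w < 1"
  shows "H2_inner (szego_kernel w) F = cnj (F w)"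
proof -
  have hol: "F holomorphic_on ball 0 1" using F by (simp add: H2_def)
  define k where "k \<theta> = szego_kernel w (cis \<theta>)" for \<theta>
  have kc: "continuous_on {0..2*pi} k"
    unfolding k_def szego_kernel_def using szego_denominator_nonzero[OF w]
    by (intro continuous_intros) auto
  have [measurable]: "k \<in> borel_measurable circle_measure"
    by (rule continuous_imp_measurable_on_sets_lebesgue[OF kc]) simp
  have "compact (k ` {0..2*pi})" using kc by (intro compact_continuous_image) auto
  then obtain C where C: "\<And>t. t \<in> {0..2*pi} \<Longrightarrow> norm (k t) \<le> C"
    by (meson bounded_iff compact_imp_bounded imageI)
  have C0: "0 \<le> C" by (rule order_trans[OF norm_ge_zero C[of 0]]) simp
  define I where "I = (LINT \<theta>|circle_measure. k \<theta> * cnj (radial_value F \<theta>))"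
  have est: "norm (I - 2 * pi * cnj (F (of_real \<rho> * w))) \<le>
    C * (2 * pi * (\<delta> + dilation_defect F \<rho> / \<delta>))"
    if \<rho>: "\<rho> \<in> {0<..<1}" and \<delta>: "0 < \<delta>" for \<rho> \<delta>
  proof -
    define x where "x \<theta> = radial_value F \<theta> - F (of_real \<rho> * cis \<theta>)" for \<theta>
    have xi: "integrable circle_measure x" and xle: "(LINT \<theta>|circle_measure. norm (x \<theta>)) \<le>
      2 * pi * (\<delta> + dilation_defect F \<rho> / \<delta>)"
      unfolding x_def[abs_def] using integrable_radial_value_minus_dilate[OF F _ _ \<delta>, of \<rho>]
        integral_radial_value_minus_dilate_le[OF F _ _ \<delta>, of \<rho>] \<rho> by auto
    have kx: "integrable circle_measure (\<lambda>\<theta>. k \<theta> * cnj (x \<theta>))"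
    proof (rule Bochner_Integration.integrable_bound)
      show "integrable circle_measure (\<lambda>\<theta>. C * norm (x \<theta>))" using xi by auto
      show "(\<lambda>\<theta>. k \<theta> * cnj (x \<theta>)) \<in> borel_measurable circle_measure"
        using borel_measurable_integrable[OF integrable_cnj[OF xi]]
        by (intro borel_measurable_times) simp_all
      show "AE \<theta> in circle_measure. norm (k \<theta> * cnj (x \<theta>)) \<le> norm (C * norm (x \<theta>))"
        using C C0 by (auto intro!: AE_I2 mult_right_mono simp: norm_mult)
    qed
    have kFc: "continuous_on {0..2*pi} (\<lambda>\<theta>. k \<theta> * cnj (F (of_real \<rho> * cis \<theta>)))"
      using \<rho> by (intro continuous_intros kc continuous_on_circle hol) auto
    have kF: "integrable circle_measure (\<lambda>\<theta>. k \<theta> * cnj (F (of_real \<rho> * cis \<theta>)))"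
      by (rule continuous_imp_integrable_real[OF kFc])
    have "I = (LINT \<theta>|circle_measure. k \<theta> * cnj (x \<theta>) + k \<theta> * cnj (F (of_real \<rho> * cis \<theta>)))"
      unfolding I_def x_def by (simp add: algebra_simps)
    also have "\<dots> = (LINT \<theta>|circle_measure. k \<theta> * cnj (x \<theta>)) +
      (LINT \<theta>|circle_measure. k \<theta> * cnj (F (of_real \<rho> * cis \<theta>)))"
      by (rule Bochner_Integration.integral_add[OF kx kF])
    also have "(LINT \<theta>|circle_measure. k \<theta> * cnj (F (of_real \<rho> * cis \<theta>))) =
      2 * pi * cnj (F (of_real \<rho> * w))"
      using lebesgue_integral_eq_integral[OF kF] integral_szego_kernel_dilate[OF hol w, of \<rho>] \<rho>
      by (simp add: k_def)
    finally have "I - 2 * pi * cnj (F (of_real \<rho> * w)) = (LINT \<theta>|circle_measure. k \<theta> * cnj (x \<theta>))"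
      by simp
    also have "norm \<dots> \<le> (LINT \<theta>|circle_measure. C * norm (x \<theta>))"
      using C xi by (intro order_trans[OF integral_norm_bound] integral_mono_AE integrable_norm kx)
         (auto intro!: AE_I2 mult_right_mono simp: norm_mult)
    also have "\<dots> = C * (LINT \<theta>|circle_measure. norm (x \<theta>))" by simp
    also have "\<dots> \<le> C * (2 * pi * (\<delta> + dilation_defect F \<rho> / \<delta>))" by (intro mult_left_mono xle C0)
    finally show ?thesis .
  qed
  have "isCont F w"
    using holomorphic_on_imp_continuous_on[OF hol] w
    by (subst (asm) continuous_on_eq_continuous_at) auto
  then have Fw: "((\<lambda>\<rho>. F (of_real \<rho> * w)) \<longlongrightarrow> F w) (at_left (1::real))"
    by (rule isCont_tendsto_compose) (auto intro!: tendsto_eq_intros)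
  have ev: "\<forall>\<^sub>F \<rho> in at_left (1::real). \<rho> \<in> {0<..<1}" by (rule eventually_at_left_real) simp
  have "norm (I - 2 * pi * cnj (F w)) \<le> C * (2 * pi * \<delta>)" if \<delta>: "0 < \<delta>" for \<delta>
  proof (rule tendsto_le[of "at_left (1::real)"])
    show "((\<lambda>\<rho>. norm (I - 2 * pi * cnj (F (of_real \<rho> * w)))) \<longlongrightarrow>
      norm (I - 2 * pi * cnj (F w))) (at_left (1::real))"
      by (intro tendsto_intros Fw)
    have "((\<lambda>\<rho>. C * (2 * pi * (\<delta> + dilation_defect F \<rho> / \<delta>))) \<longlongrightarrow>
      C * (2 * pi * (\<delta> + 0 / \<delta>))) (at_left (1::real))"
      using \<delta> by (intro tendsto_intros tendsto_dilation_defect F) auto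
    then show "((\<lambda>\<rho>. C * (2 * pi * (\<delta> + dilation_defect F \<rho> / \<delta>))) \<longlongrightarrow>
      C * (2 * pi * \<delta>)) (at_left (1::real))" by simp
    show "\<forall>\<^sub>F \<rho> in at_left (1::real). norm (I - 2 * pi * cnj (F (of_real \<rho> * w))) \<le>
      C * (2 * pi * (\<delta> + dilation_defect F \<rho> / \<delta>))"
      using ev by eventually_elim (rule est[OF _ \<delta>])
  qed simp
  then have "\<forall>\<^sub>F \<delta> in at_right (0::real). norm (I - 2 * pi * cnj (F w)) \<le> C * (2 * pi * \<delta>)"
    by (auto simp: eventually_at_right_field intro!: exI[of _ 1])
  moreover have "((\<lambda>\<delta>. C * (2 * pi * \<delta>)) \<longlongrightarrow> 0) (at_right (0::real))"
    by (auto intro!: tendsto_eq_intros)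
  ultimately have "norm (I - 2 * pi * cnj (F w)) \<le> 0" by (intro tendsto_lowerbound) auto
  then have "I = 2 * pi * cnj (F w)" by simp
  then show ?thesis by (simp add: H2_inner_def radial_value_szego_kernel[OF w] I_def k_def)
qed

section \<open>Frames of iterates\<close>

lemma mult_op_power: "(mult_op \<phi> ^^ n) f z = \<phi> z ^ n * f z"
  by (induction n) (auto simp: mult_op_def)

text \<open>
  Against the Szego kernel at \<open>w\<close> the frame coefficients are conjugates of the point values \<open>\<phi> w
  ^ n * f w\<close>, so the frame sum is a geometric series with ratio \<open>\<bar>\<phi> w\<bar>\<^sup>2\<close>. Its sum being
  positive and finite forces \<open>f w \<noteq> 0\<close> and \<open>\<bar>\<phi> w\<bar> < 1\<close>; the inequality is the lower frame bound.
\<close>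
lemma frame_lower_bound_on_kernels:
  assumes "H2_frame (\<lambda>n. (mult_op \<phi> ^^ n) f)"
  obtains A where "0 < A" "\<And>w. norm w < 1 \<Longrightarrow> norm (\<phi> w) < 1"
    "\<And>w. norm w < 1 \<Longrightarrow> A * (1 - (norm (\<phi> w))\<^sup>2) \<le> (1 - (norm w)\<^sup>2) * (norm (f w))\<^sup>2"
proof -
  define e where "e n = (mult_op \<phi> ^^ n) f" for n
  obtain A where A: "0 < A" and fr: "\<And>g. g \<in> H2 \<Longrightarrow> summable (\<lambda>n. (cmod (H2_inner g (e n)))\<^sup>2) \<and>
        A * (H2_norm g)\<^sup>2 \<le> (\<Sum>n. (cmod (H2_inner g (e n)))\<^sup>2)"
    using assms unfolding H2_frame_def e_def by meson
  have eH: "e n \<in> H2" for n using assms unfolding H2_frame_def e_def by blast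
  have main: "norm (\<phi> w) < 1 \<and> A * (1 - (norm (\<phi> w))\<^sup>2) \<le> (1 - (norm w)\<^sup>2) * (norm (f w))\<^sup>2"
    if w: "norm w < 1" for w
  proof -
    have w2: "(norm w)\<^sup>2 < 1" using w by (simp add: abs_square_less_1)
    define q where "q = (norm (\<phi> w))\<^sup>2"
    have "(\<lambda>n. (cmod (H2_inner (szego_kernel w) (e n)))\<^sup>2) = (\<lambda>n. (norm (f w))\<^sup>2 * q ^ n)"
      unfolding H2_inner_szego_kernel[OF eH w]
      by (simp add: e_def mult_op_power norm_mult norm_power q_def power_mult_distrib
      power_mult[symmetric] mult.commute)
    with fr[OF szego_kernel_in_H2[OF w]]
    have s: "summable (\<lambda>n. (norm (f w))\<^sup>2 * q ^ n)" and le: "A / (1 - (norm w)\<^sup>2) \<le>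
      (\<Sum>n. (norm (f w))\<^sup>2 * q ^ n)"
      using H2_norm_szego_kernel[OF w] by auto
    have "0 < A / (1 - (norm w)\<^sup>2)" using A w2 by simp
    with le have "f w \<noteq> 0" by auto
    then have "summable (\<lambda>n. q ^ n)" using s by (simp add: summable_cmult_iff)
    then have q: "q < 1" by (simp add: summable_geometric_iff q_def)
    then have "(\<Sum>n. (norm (f w))\<^sup>2 * q ^ n) = (norm (f w))\<^sup>2 / (1 - q)"
      by (subst suminf_mult) (auto simp: suminf_geometric q_def summable_geometric)
    with le have "A / (1 - (norm w)\<^sup>2) \<le> (norm (f w))\<^sup>2 / (1 - q)" by simp
    then have "A * (1 - q) \<le> (1 - (norm w)\<^sup>2) * (norm (f w))\<^sup>2"
      using q w2 by (simp add: pos_divide_le_eq pos_le_divide_eq mult_ac)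
    moreover have "norm (\<phi> w) < 1" using q unfolding q_def by (simp add: abs_square_less_1)
    ultimately show ?thesis by (simp add: q_def)
  qed
  with A show thesis by (intro that[of A]) auto
qed

theorem proposition2p1:
  fixes \<phi> f :: "complex \<Rightarrow> complex"
  assumes "\<phi> \<in> Hinf"
    and "f \<in> H2"
    and "H2_frame (\<lambda>n. (mult_op \<phi> ^^ n) f)"
  shows "inner_function \<phi>"
proof -
  obtain A where A: "0 < A" and lt: "\<And>w. norm w < 1 \<Longrightarrow> norm (\<phi> w) < 1"
    and le: "\<And>w. norm w < 1 \<Longrightarrow> A * (1 - (norm (\<phi> w))\<^sup>2) \<le> (1 - (norm w)\<^sup>2) * (norm (f w))\<^sup>2"
    by (rule frame_lower_bound_on_kernels[OF assms(3)]) blast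
  have "AE \<theta> in circle_measure. ((\<lambda>r. \<phi> (of_real r * cis \<theta>)) \<longlongrightarrow>
    radial_value \<phi> \<theta>) (at_left (1::real)) \<and>
        cmod (radial_value \<phi> \<theta>) = 1"
    using AE_tendsto_radial_value[OF Hinf_subset_H2[OF assms(1)]] AE_tendsto_radial_value[OF
    assms(2)]
  proof eventually_elim
    case (elim \<theta>)
    have ev: "\<forall>\<^sub>F r in at_left (1::real). r \<in> {0<..<1}" by (rule eventually_at_left_real) simp
    have "A * (1 - (cmod (radial_value \<phi> \<theta>))\<^sup>2) \<le> (1 - 1\<^sup>2) * (norm (radial_value f \<theta>))\<^sup>2"
    proof (rule tendsto_le[of "at_left (1::real)"])
      show "((\<lambda>r. (1 - r\<^sup>2) * (norm (f (of_real r * cis \<theta>)))\<^sup>2) \<longlongrightarrow>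
        (1 - 1\<^sup>2) * (norm (radial_value f \<theta>))\<^sup>2) (at_left (1::real))"
        by (intro tendsto_intros elim)
      show "((\<lambda>r. A * (1 - (norm (\<phi> (of_real r * cis \<theta>)))\<^sup>2)) \<longlongrightarrow>
        A * (1 - (cmod (radial_value \<phi> \<theta>))\<^sup>2)) (at_left (1::real))"
        by (intro tendsto_intros elim)
      show "\<forall>\<^sub>F r in at_left (1::real). A * (1 - (norm (\<phi> (of_real r * cis \<theta>)))\<^sup>2) \<le>
        (1 - r\<^sup>2) * (norm (f (of_real r * cis \<theta>)))\<^sup>2"
        using ev
      proof eventually_elim
        case (elim r)
        then show ?case using le[of "of_real r * cis \<theta>"] by (simp add: norm_mult)
      qed
    qed simp
    then have "1 \<le> (cmod (radial_value \<phi> \<theta>))\<^sup>2" using A by (simp add: mult_le_0_iff)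
    then have "1 \<le> cmod (radial_value \<phi> \<theta>)" using power2_le_imp_le[of 1 "cmod (radial_value \<phi> \<theta>)"]
      by simp
    moreover have "cmod (radial_value \<phi> \<theta>) \<le> 1"
    proof (rule tendsto_upperbound)
      show "((\<lambda>r. norm (\<phi> (of_real r * cis \<theta>))) \<longlongrightarrow> cmod (radial_value \<phi> \<theta>)) (at_left (1::real))"
        by (intro tendsto_intros elim)
      show "\<forall>\<^sub>F r in at_left (1::real). norm (\<phi> (of_real r * cis \<theta>)) \<le> 1"
        using ev by eventually_elim (auto intro!: less_imp_le[OF lt] simp: norm_mult)
    qed simp
    ultimately show ?case using elim(1) by simp
  qed
  with assms(1) show ?thesis by (simp add: inner_function_def)
qed

end
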